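(* Let $k\geq 2$ be an integer, and let $G$ be a graph. If $$\delta(G)\geq\frac{2\alpha(G)}{2k+1},$$ then $G$ has a $\{K_{1,1},K_{1,2},\ldots,K_{1,k},\mathcal{T}(2k+1)\}$-factor.
   Context: All graphs are finite, undirected, without loops or multiple edges; $\delta(G)$ is the minimum degree and $\alpha(G)$ the independence number of $G$. $K_{1,j}$ denotes the star with $j$ leaves. For a set $\mathcal{H}$ of connected graphs, an $\mathcal{H}$-factor of $G$ is a spanning subgraph of $G$ each of whose connected components is isomorphic to an element of $\mathcal{H}$. The family $\mathcal{T}(2k+1)$ ($k\geq2$) is defined as follows. For a tree $T$, $Leaf(T)$ is its set of leaves. Let $R$ be a tree such that for every $x\in V(R)\setminus Leaf(R)$: (a) $d_{R-Leaf(R)}(x)\in\{1,3,\ldots,2k+1\}$, and (b) $2\cdot(\text{number of leaves of } R \text{ adjacent to } x)+d_{R-Leaf(R)}(x)\leq 2k+1$. From such $R$ build a tree $T_R$ by (c) inserting a new vertex of degree 2 into each edge of $R-Leaf(R)$, and (d) for every vertex $x$ of $R-Leaf(R)$ with $d_{R-Leaf(R)}(x)=2r+1<2k+1$, attaching $k-r-(\text{number of leaves of } R \text{ adjacent to } x)$ new pendant edges to $x$. Then $\mathcal{T}(2k+1)$ is the set of all trees $T_R$ over all trees $R$ satisfying (a) and (b). A $\{K_{1,1},\ldots,K_{1,k},\mathcal{T}(2k+1)\}$-factor is an $\mathcal{H}$-factor with $\mathcal{H}=\{K_{1,1},\ldots,K_{1,k}\}\cup\mathcal{T}(2k+1)$.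 *)

theory Defs
  imports Complex_Main "Graph_Theory.Graph_Theory"
begin

text \<open>
  Finite simple undirected graphs are the \<open>pair_graph\<close>s of \<open>Graph_Theory\<close>: finite, loop-free,
  symmetric arc relations, an undirected edge \<open>xy\<close> being the two arcs \<open>(x, y)\<close> and \<open>(y, x)\<close>.
  Accordingly the degree of a vertex is its \<open>out_degree\<close>, and the connected components of a graph
  are its \<open>sccs\<close>.
\<close>

text \<open>For the null graph, which has no minimum degree, the value is unspecified.\<close>

definition min_degree :: "'a pair_pre_digraph \<Rightarrow> nat" where
  "min_degree G = Min (out_degree (with_proj G) ` pverts G)"

definition independent_set :: "'a pair_pre_digraph \<Rightarrow> 'a set \<Rightarrow> bool" where
  "independent_set G S \<longleftrightarrow> S \<subseteq> pverts G \<and> (\<forall>u\<in>S. \<forall>v\<in>S. (u, v) \<notin> parcs G)"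

definition independence_number :: "'a pair_pre_digraph \<Rightarrow> nat" where
  "independence_number G = Max (card ` {S. independent_set G S})"

definition has_factor :: "'b pair_pre_digraph set \<Rightarrow> 'a pair_pre_digraph \<Rightarrow> bool" where
  "has_factor \<H> G \<longleftrightarrow>
     (\<exists>F. pair_graph F \<and> spanning (with_proj F) (with_proj G) \<and>
          (\<forall>C \<in> pre_digraph.sccs (with_proj F). \<exists>H\<in>\<H>. digraph_iso C (with_proj H)))"

definition stars_upto :: "nat \<Rightarrow> 'b pair_pre_digraph set" where
  "stars_upto k = {S. \<exists>j\<in>{1..k}. complete_bipartite_digraph 1 j (with_proj S)}"

text \<open>
  The library predicate \<open>tree\<close> does not fit here: it counts the closed walk \<open>x, y, x\<close> along a single
  edge as a cycle. A cycle of an undirected graph has length at least 3.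
\<close>

definition undirected_tree :: "'a pair_pre_digraph \<Rightarrow> bool" where
  "undirected_tree T \<longleftrightarrow> pair_graph T \<and> Digraph_Component.connected (with_proj T) \<and>
     \<not> (\<exists>p. pre_digraph.cycle (with_proj T) p \<and> 3 \<le> length p)"

definition leaves :: "'a pair_pre_digraph \<Rightarrow> 'a set" where
  "leaves T = {x \<in> pverts T. out_degree (with_proj T) x = 1}"

definition leaf_nbrs :: "'a pair_pre_digraph \<Rightarrow> 'a \<Rightarrow> 'a set" where
  "leaf_nbrs R x = {y \<in> leaves R. (x, y) \<in> parcs R}"

definition without_leaves :: "'a pair_pre_digraph \<Rightarrow> ('a, 'a \<times> 'a) pre_digraph" where
  "without_leaves R = with_proj R \<restriction> (pverts R - leaves R)"

definition admissible_tree :: "nat \<Rightarrow> 'a pair_pre_digraph \<Rightarrow> bool" where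
  "admissible_tree k R \<longleftrightarrow> undirected_tree R \<and>
     (\<forall>x \<in> pverts R - leaves R.
        out_degree (without_leaves R) x \<in> {2 * r + 1 | r. r \<le> k} \<and>
        2 * card (leaf_nbrs R x) + out_degree (without_leaves R) x \<le> 2 * k + 1)"

text \<open>
  Vertices of the tree built from \<open>R\<close>: the vertices of \<open>R\<close>, a vertex \<open>Mid {x, y}\<close> inserted into each
  edge \<open>xy\<close> of \<open>R\<close> without its leaves, and the end vertices \<open>Pend x i\<close> of the new pendant edges at \<open>x\<close>.
\<close>

datatype 'a expanded_vertex = Orig 'a | Mid "'a set" | Pend 'a nat

text \<open>
  The pairs \<open>(x, i)\<close>, one for each new pendant edge at \<open>x\<close>. If \<open>R\<close> is admissible, then the
  subtractions on natural numbers do not truncate.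
\<close>

definition new_pendants :: "nat \<Rightarrow> 'a pair_pre_digraph \<Rightarrow> ('a \<times> nat) set" where
  "new_pendants k R =
     {(x, i). x \<in> pverts R - leaves R \<and>
        (\<exists>r. out_degree (without_leaves R) x = 2 * r + 1 \<and> 2 * r + 1 < 2 * k + 1 \<and>
             i < k - r - card (leaf_nbrs R x))}"

definition expand_tree :: "nat \<Rightarrow> 'a pair_pre_digraph \<Rightarrow> 'a expanded_vertex pair_pre_digraph" where
  "expand_tree k R =
     (let A = {(Orig x, Orig y) | x y. (x, y) \<in> parcs R - arcs (without_leaves R)}
            \<union> {(Orig x, Mid {x, y}) | x y. (x, y) \<in> arcs (without_leaves R)}
            \<union> {(Orig x, Pend x i) | x i. (x, i) \<in> new_pendants k R}
      in \<lparr> pverts = Orig ` pverts R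
                  \<union> {Mid {x, y} | x y. (x, y) \<in> arcs (without_leaves R)}
                  \<union> {Pend x i | x i. (x, i) \<in> new_pendants k R},
           parcs = A \<union> A\<inverse> \<rparr>)"

text \<open>
  The family \<open>\<T>(2k + 1)\<close>. Every finite tree has an isomorphic copy on natural numbers, and factors
  only refer to members of the family up to isomorphism.
\<close>

definition tree_family :: "nat \<Rightarrow> nat expanded_vertex pair_pre_digraph set" where
  "tree_family k = {expand_tree k R | R. admissible_tree k R}"

end

theory Submission
  imports Defs
begin

text \<open>
  Let every vertex \<open>v\<close> either be a center or hand out two units to adjacent centers (\<open>f v c\<close> units to
  \<open>c\<close>), no center receiving more than \<open>2k + 1\<close> units. Take such an \<open>f\<close> covering as much as possible.
  From a vertex \<open>w\<close> with a unit left one explores alternating paths; by maximality they only meet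
  centers that are full, and the vertices at even distance form an independent set \<open>I\<close> with
  \<open>(2k + 1)|N(I)| < 2|I|\<close>. As \<open>|I| \<le> \<alpha>\<close> and \<open>|N(I)| \<ge> \<delta>\<close>, this contradicts the degree condition, so
  nothing is left over.

  Among the complete \<open>f\<close> choose one with the fewest vertices giving to two different centers
  (``doubles''). A center that receives from a double must be full, as otherwise the double
  could give both units to it; and doubles never close a cycle, as otherwise each double on the
  cycle could give both units to the next center. Hence a component without doubles is a star with at
  most \<open>k\<close> leaves, and in a component with doubles every center with \<open>p\<close> pendant vertices and \<open>d\<close>
  doubles satisfies \<open>2p + d = 2k + 1\<close>; contracting the doubles gives the tree \<open>R\<close> of the family.
\<close>

section \<open>Covering all vertices\<close>

locale finite_graph =
  fixes V :: "'a set" and E :: "('a \<times> 'a) set" and k :: nat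
  assumes finite_V: "finite V"
    and E_sub: "E \<subseteq> V \<times> V"
    and E_sym: "(x, y) \<in> E \<Longrightarrow> (y, x) \<in> E"
    and E_irrefl: "(x, x) \<notin> E"
    and k_ge_2: "2 \<le> k"
begin

section \<open>Assignments of units to centers\<close>

definition load :: "('a \<Rightarrow> 'a \<Rightarrow> nat) \<Rightarrow> 'a \<Rightarrow> nat" where
  "load f c = (\<Sum>v\<in>V. f v c)"

definition units :: "('a \<Rightarrow> 'a \<Rightarrow> nat) \<Rightarrow> 'a \<Rightarrow> nat" where
  "units f v = (\<Sum>c\<in>V. f v c)"

text \<open>Centers are not recorded separately: a vertex is a center when its load is positive, and
  such a vertex must not give. The edge clause makes \<open>f\<close> vanish outside
  \<open>V\<close>, so the other clauses may range over the whole type.\<close>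

definition valid :: "('a \<Rightarrow> 'a \<Rightarrow> nat) \<Rightarrow> bool" where
  "valid f \<longleftrightarrow> (\<forall>v c. 0 < f v c \<longrightarrow> (v, c) \<in> E) \<and> (\<forall>c. load f c \<le> 2 * k + 1) \<and>
     (\<forall>v. units f v \<le> 2) \<and> (\<forall>v. 0 < load f v \<longrightarrow> units f v = 0)"

lemma E_in_V: "(x, y) \<in> E \<Longrightarrow> x \<in> V \<and> y \<in> V"
  using E_sub by auto

lemma validD:
  assumes "valid f"
  shows valid_edge: "0 < f v c \<Longrightarrow> (v, c) \<in> E"
    and valid_load: "load f c \<le> 2 * k + 1"
    and valid_units: "units f v \<le> 2"
    and valid_center: "0 < load f v \<Longrightarrow> units f v = 0"
  using assms by (auto simp: valid_def)

lemma le_load: "v \<in> V \<Longrightarrow> f v c \<le> load f c"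
  unfolding load_def using finite_V by (intro member_le_sum) auto

lemma le_units: "c \<in> V \<Longrightarrow> f v c \<le> units f v"
  unfolding units_def using finite_V by (intro member_le_sum) auto

lemma valid_le_load: "valid f \<Longrightarrow> f v c \<le> load f c"
  by (metis E_in_V le_load valid_edge not_gr_zero zero_le)

lemma valid_le_units: "valid f \<Longrightarrow> f v c \<le> units f v"
  by (metis E_in_V le_units valid_edge not_gr_zero zero_le)

lemma load_upd: "v \<in> V \<Longrightarrow> load (f(v := g)) c + f v c = load f c + g c"
  unfolding load_def using finite_V by (simp add: sum.remove)

lemma units_upd: "units (f(v := g)) x = (if x = v then \<Sum>c\<in>V. g c else units f x)"
  by (simp add: units_def)

lemma sum_point: "c \<in> V \<Longrightarrow> (\<Sum>x\<in>V. (g(c := b)) x) + g c = (\<Sum>x\<in>V. g x) + (b::nat)"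
  using finite_V by (simp add: sum.remove)

section \<open>Promotion of a vertex to a center\<close>

text \<open>
  When \<open>u\<close> is promoted to a center, the centers \<open>robbed f u\<close> that thereby lose their whole load become
  satellites of \<open>u\<close>; there are at most two of them, so \<open>u\<close> receives at most four units.
\<close>

definition robbed :: "('a \<Rightarrow> 'a \<Rightarrow> nat) \<Rightarrow> 'a \<Rightarrow> 'a set" where
  "robbed f u = {c \<in> V. 0 < f u c \<and> load f c = f u c}"

definition promote :: "('a \<Rightarrow> 'a \<Rightarrow> nat) \<Rightarrow> 'a \<Rightarrow> 'a \<Rightarrow> 'a \<Rightarrow> nat" where
  "promote f u = (\<lambda>x. if x = u then (\<lambda>_. 0)
     else if x \<in> robbed f u then (\<lambda>c. if c = u then 2 else 0) else f x)"

text \<open>A robbed center received only from \<open>u\<close> and, being a center, gave nothing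
  itself. Overwriting its row therefore takes load from nobody, and the load of a vertex other than
  \<open>u\<close> drops only by what \<open>u\<close> withdraws. Each robbed center used up at
  least one of the at most two units of \<open>u\<close>.\<close>

lemma promote:
  assumes f: "valid f" and u: "u \<in> V" "load f u = 0"
  shows "valid (promote f u)"
    and "c \<noteq> u \<Longrightarrow> load (promote f u) c + f u c = load f c"
    and "load (promote f u) u = 2 * card (robbed f u)"
    and "units (promote f u) x =
          (if x = u then 0 else if x \<in> robbed f u then 2 else units f x)"
    and "card (robbed f u) \<le> 2"
proof -
  let ?Z = "robbed f u" and ?f = "promote f u"
  have Z: "?Z \<subseteq> V" "finite ?Z" using finite_V by (auto simp: robbed_def)
  have fZ: "f z c = 0" if "z \<in> ?Z" for z c
    using that f valid_le_units[OF f, of z c] valid_center[OF f, of z] by (auto simp: robbed_def)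
  have fu: "f x u = 0" for x using valid_le_load[OF f, of x u] u by simp
  have uZ: "u \<notin> ?Z" using fu by (auto simp: robbed_def)
  have "card ?Z = (\<Sum>c\<in>?Z. 1)" by simp
  also have "\<dots> \<le> (\<Sum>c\<in>?Z. f u c)" by (intro sum_mono) (auto simp: robbed_def)
  also have "\<dots> \<le> units f u" unfolding units_def using Z finite_V by (intro sum_mono2) auto
  also have "\<dots> \<le> 2" using valid_units[OF f] .
  finally show cZ: "card ?Z \<le> 2" .
  show lo: "load ?f c + f u c = load f c" if "c \<noteq> u" for c
  proof -
    have "load f c = (\<Sum>x\<in>V. ?f x c + (if x = u then f u c else 0))"
      unfolding load_def using that by (intro sum.cong) (auto simp: promote_def fZ)
    also have "\<dots> = load ?f c + f u c"
      using finite_V u by (simp add: sum.distrib load_def)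
    finally show ?thesis by simp
  qed
  have "load ?f u = (\<Sum>x\<in>V. if x \<in> ?Z then 2 else 0)"
    unfolding load_def using uZ by (intro sum.cong) (auto simp: promote_def fu)
  also have "\<dots> = (\<Sum>x\<in>?Z. 2)" using Z finite_V by (simp add: sum.If_cases Int_absorb1)
  finally show lu: "load ?f u = 2 * card ?Z" by simp
  show su: "units ?f x = (if x = u then 0 else if x \<in> ?Z then 2 else units f x)" for x
    using u finite_V by (auto simp: units_def promote_def)
  show "valid ?f"
    unfolding valid_def
  proof (intro conjI allI impI)
    fix v c assume "0 < ?f v c"
    then show "(v, c) \<in> E"
      using valid_edge[OF f] by (auto simp: promote_def robbed_def E_sym split: if_splits)
  next
    \<comment> \<open>The vertex \<open>u\<close> receives at most four units, which is allowed
      because \<open>2 * k + 1\<close> is at least 5.\<close>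
    fix c show "load ?f c \<le> 2 * k + 1"
      using lo[of c] lu cZ k_ge_2 valid_load[OF f, of c] by (cases "c = u") auto
  next
    fix v show "units ?f v \<le> 2" using su[of v] valid_units[OF f, of v] by simp
  next
    fix v assume v: "0 < load ?f v"
    \<comment> \<open>A robbed center is left with load 0, so it may give its two units to
      \<open>u\<close>.\<close>
    have "v \<notin> ?Z" if "v \<noteq> u" using lo[OF that] v by (auto simp: robbed_def)
    then show "units ?f v = 0"
      using v lo[of v] su[of v] valid_center[OF f, of v] by (cases "v = u") auto
  qed
qed

section \<open>Adding and removing a single unit\<close>

definition grow :: "('a \<Rightarrow> 'a \<Rightarrow> nat) \<Rightarrow> 'a \<Rightarrow> 'a \<Rightarrow> 'a \<Rightarrow> 'a \<Rightarrow> nat" where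
  "grow f w c = f(w := (f w)(c := f w c + 1))"

lemma load_grow: "w \<in> V \<Longrightarrow> load (grow f w c) x = (if x = c then load f x + 1 else load f x)"
  using load_upd[of w f "(f w)(c := f w c + 1)" x] by (auto simp: grow_def split: if_splits)

lemma units_grow: "c \<in> V \<Longrightarrow> units (grow f w c) x = (if x = w then units f x + 1 else units f x)"
  using sum_point[of c "f w" "f w c + 1"] by (auto simp: grow_def units_upd) (auto simp: units_def)

lemma valid_grow:
  assumes f: "valid f" and "(w, c) \<in> E" "load f w = 0" "units f w \<le> 1"
    and "load f c \<le> 2 * k" "units f c = 0"
  shows "valid (grow f w c)"
proof -
  have "w \<in> V" "c \<in> V" "w \<noteq> c" using assms E_in_V E_irrefl by auto
  then show ?thesis
    using assms validD[OF f] unfolding valid_def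
    by (auto simp: load_grow units_grow) (auto simp: grow_def split: if_splits)
qed

definition shrink :: "('a \<Rightarrow> 'a \<Rightarrow> nat) \<Rightarrow> 'a \<Rightarrow> 'a \<Rightarrow> 'a \<Rightarrow> 'a \<Rightarrow> nat" where
  "shrink f u c = f(u := (f u)(c := f u c - 1))"

lemma load_shrink:
  "u \<in> V \<Longrightarrow> 0 < f u c \<Longrightarrow> load (shrink f u c) x = (if x = c then load f x - 1 else load f x)"
  using load_upd[of u f "(f u)(c := f u c - 1)" x] by (auto simp: shrink_def split: if_splits)

lemma units_shrink:
  "c \<in> V \<Longrightarrow> 0 < f u c \<Longrightarrow> units (shrink f u c) x = (if x = u then units f x - 1 else units f x)"
  using sum_point[of c "f u" "f u c - 1"] by (auto simp: shrink_def units_upd) (auto simp: units_def)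

lemma valid_shrink:
  assumes f: "valid f" and uc: "0 < f u c"
  shows "valid (shrink f u c)"
proof -
  have uV: "u \<in> V" "c \<in> V" using valid_edge[OF f uc] E_in_V by auto
  have le: "units (shrink f u c) x \<le> units f x" "load (shrink f u c) x \<le> load f x" for x
    using uV uc by (auto simp: load_shrink units_shrink)
  have pos: "0 < f x y" if "0 < shrink f u c x y" for x y
    using that uc by (auto simp: shrink_def split: if_splits)
  show ?thesis
    unfolding valid_def
  proof (intro conjI allI impI)
    show "(x, y) \<in> E" if "0 < shrink f u c x y" for x y using pos[OF that] valid_edge[OF f] by blast
    show "load (shrink f u c) x \<le> 2 * k + 1" for x using le(2)[of x] valid_load[OF f, of x] by simp
    show "units (shrink f u c) x \<le> 2" for x using le(1)[of x] valid_units[OF f, of x] by simp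
    show "units (shrink f u c) x = 0" if "0 < load (shrink f u c) x" for x
      using le[of x] that valid_center[OF f, of x] by simp
  qed
qed

section \<open>Assignments that cover as much as possible\<close>

definition covered :: "('a \<Rightarrow> 'a \<Rightarrow> nat) \<Rightarrow> 'a \<Rightarrow> nat" where
  "covered f v = (if 0 < load f v then 2 else units f v)"

text \<open>For a valid \<open>f\<close> this is at most twice the number of vertices, with equality
  exactly when every vertex is a center or gives two units.\<close>

definition total :: "('a \<Rightarrow> 'a \<Rightarrow> nat) \<Rightarrow> nat" where
  "total f = (\<Sum>v\<in>V. covered f v)"

definition maximal :: "('a \<Rightarrow> 'a \<Rightarrow> nat) \<Rightarrow> bool" where
  "maximal f \<longleftrightarrow> valid f \<and> (\<forall>g. valid g \<longrightarrow> total g \<le> total f)"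

definition deficient :: "('a \<Rightarrow> 'a \<Rightarrow> nat) \<Rightarrow> 'a \<Rightarrow> bool" where
  "deficient f v \<longleftrightarrow> v \<in> V \<and> load f v = 0 \<and> units f v \<le> 1"

lemma covered_le: "valid f \<Longrightarrow> covered f v \<le> 2"
  by (simp add: covered_def valid_units)

lemma ex_maximal: "\<exists>f. maximal f"
proof -
  have "valid (\<lambda>_ _. 0)" by (simp add: valid_def load_def units_def)
  moreover have "\<forall>f. valid f \<longrightarrow> total f < 2 * card V + 1"
  proof (intro allI impI)
    fix f assume "valid f"
    then have "total f \<le> (\<Sum>v\<in>V. 2)" unfolding total_def by (intro sum_mono covered_le)
    then show "total f < 2 * card V + 1" by simp
  qed
  ultimately show ?thesis
    unfolding maximal_def using ex_has_greatest_nat[of valid "\<lambda>_ _. 0" total "2 * card V + 1"] by auto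
qed

lemma maximal_no_improvement:
  assumes "maximal f" "valid g" "\<And>v. covered f v \<le> covered g v" "w \<in> V"
  shows "covered g w \<le> covered f w"
proof (rule ccontr)
  assume "\<not> covered g w \<le> covered f w"
  then have "total f < total g"
    unfolding total_def using assms finite_V by (intro sum_strict_mono_ex1) (auto simp: not_le)
  then show False using assms by (auto simp: maximal_def not_le dest: leD)
qed

text \<open>Otherwise \<open>w\<close> could give one more unit to \<open>c\<close>: directly if
  \<open>c\<close> is a center with room, and after promoting \<open>c\<close> if it is not yet a
  center. In both cases no other vertex loses coverage while \<open>w\<close> gains, against
  maximality.\<close>

lemma maximal_saturated:
  assumes f: "maximal f" and w: "deficient f w" and e: "(w, c) \<in> E"
  shows "load f c = 2 * k + 1"
proof (rule ccontr)
  assume ne: "load f c \<noteq> 2 * k + 1"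
  have vf: "valid f" using f by (simp add: maximal_def)
  have wc: "w \<in> V" "c \<in> V" "w \<noteq> c" using e E_in_V E_irrefl by auto
  have lw: "load f w = 0" "units f w \<le> 1" using w by (auto simp: deficient_def)
  show False
  proof (cases "0 < load f c")
    case True
    define g where "g = grow f w c"
    have "valid g" unfolding g_def
      using vf e lw ne valid_load[OF vf, of c] valid_center[OF vf True] by (intro valid_grow) auto
    moreover have "covered f v \<le> covered g v" for v
      using wc by (auto simp: g_def covered_def load_grow units_grow valid_units[OF vf])
    ultimately have "covered g w \<le> covered f w"
      using maximal_no_improvement[OF f] wc by blast
    then show False using wc lw by (auto simp: g_def covered_def load_grow units_grow)
  next
    case False
    then have c0: "load f c = 0" by simp
    let ?p = "promote f c"
    note pr = promote[OF vf wc(2) c0]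
    have fc: "f x c = 0" for x using valid_le_load[OF vf, of x c] c0 by simp
    have wZ: "w \<notin> robbed f c" using lw by (auto simp: robbed_def)
    have lpw: "load ?p w = 0" using pr(2)[of w] lw wc by simp
    have spw: "units ?p w = units f w" using pr(4)[of w] wc wZ by simp
    define g where "g = grow ?p w c"
    \<comment> \<open>Promotion leaves \<open>c\<close> with load at most 4, hence at most
      \<open>2 * k\<close>, so one more unit fits.\<close>
    have vg: "valid g" unfolding g_def
      using pr(1) e lpw spw lw pr(3,5) k_ge_2 pr(4)[of c] by (intro valid_grow) auto
    have lg: "load g x = (if x = c then load ?p x + 1 else load ?p x)" for x
      using wc by (simp add: g_def load_grow)
    have sg: "units g x = (if x = w then units ?p x + 1 else units ?p x)" for x
      using wc by (simp add: g_def units_grow)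
    have "covered f v \<le> covered g v" for v
    proof -
      consider "v = c" | "v \<in> robbed f c" "v \<noteq> c" | "v \<noteq> c" "v \<notin> robbed f c" "0 < load f v"
        | "v \<noteq> c" "v \<notin> robbed f c" "load f v = 0" by blast
      then show ?thesis
      proof cases
        case 1 then show ?thesis using covered_le[OF vf, of v] by (simp add: covered_def lg)
      next
        case 2 then show ?thesis
          using covered_le[OF vf, of v] wZ pr(4)[of v] sg[of v] by (auto simp: covered_def)
      next
        case 3
        \<comment> \<open>A center that received from \<open>c\<close> alone would be robbed; every
          other center keeps a positive load.\<close>
        have "load f v \<noteq> f c v"
        proof
          assume eq: "load f v = f c v"
          with 3 have "(c, v) \<in> E" using valid_edge[OF vf, of c v] by simp
          with 3 eq E_in_V show False by (auto simp: robbed_def)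
        qed
        then have "0 < load ?p v" using pr(2)[OF 3(1)] by linarith
        with 3 show ?thesis by (simp add: covered_def lg)
      next
        case 4 then show ?thesis
          using pr(2)[of v] pr(4)[of v] by (auto simp: covered_def lg sg)
      qed
    qed
    with vg have "covered g w \<le> covered f w"
      using maximal_no_improvement[OF f] wc by blast
    then show False using wc lw lpw spw by (auto simp: covered_def lg sg)
  qed
qed

text \<open>Replacing a unit from \<open>u\<close> to \<open>c\<close> by a unit from
  \<open>v\<close> to \<open>c\<close> moves the deficiency from \<open>v\<close> to
  \<open>u\<close> and changes neither the loads nor the total. Only the rows of \<open>u\<close>
  and \<open>v\<close> are altered, which allows such exchanges to be iterated along a path.\<close>

lemma maximal_shift:
  assumes f: "maximal f" and v: "deficient f v" and e: "(v, c) \<in> E" and uc: "0 < f u c" and "u \<noteq> v"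
  obtains g where "maximal g" "deficient g u" "load g = load f" "\<And>x. x \<noteq> u \<Longrightarrow> x \<noteq> v \<Longrightarrow> g x = f x"
proof
  define g where "g = grow (shrink f u c) v c"
  have vf: "valid f" using f by (simp add: maximal_def)
  have V: "u \<in> V" "c \<in> V" "v \<in> V" "v \<noteq> c" using e valid_edge[OF vf uc] E_in_V E_irrefl by auto
  have lc: "0 < load f c" using valid_le_load[OF vf, of u c] uc by simp
  have su: "0 < units f u" using valid_le_units[OF vf, of u c] uc by simp
  have lu: "load f u = 0" using valid_center[OF vf, of u] su by (cases "load f u") auto
  have lv: "load f v = 0" "units f v \<le> 1" using v by (auto simp: deficient_def)
  have lg: "load g = load f"
    using V uc lc by (auto simp: g_def load_grow load_shrink)
  have sg: "units g x = (if x = v then units f x + 1 else if x = u then units f x - 1 else units f x)" for x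
    using V uc \<open>u \<noteq> v\<close> by (auto simp: g_def units_grow units_shrink)
  have vg: "valid g" unfolding g_def
    using V uc lv lc \<open>u \<noteq> v\<close> valid_load[OF vf, of c] valid_center[OF vf lc] e
    by (intro valid_grow valid_shrink vf) (auto simp: load_shrink units_shrink)
  \<comment> \<open>The correction terms stand on opposite sides to avoid subtraction of natural
    numbers.\<close>
  have "(\<Sum>x\<in>V. covered g x + (if x = u then 1 else 0)) = (\<Sum>x\<in>V. covered f x + (if x = v then 1 else 0))"
    using su lu lv \<open>u \<noteq> v\<close> by (intro sum.cong) (auto simp: covered_def lg sg)
  then have "total g = total f" using finite_V V by (simp add: total_def sum.distrib)
  then show "maximal g" using f vg by (simp add: maximal_def)
  show "deficient g u" using V lu lg sg[of u] \<open>u \<noteq> v\<close> valid_units[OF vf, of u] by (auto simp: deficient_def)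
  show "load g = load f" by fact
  show "\<And>x. x \<noteq> u \<Longrightarrow> x \<noteq> v \<Longrightarrow> g x = f x" by (simp add: g_def grow_def shrink_def)
qed

text \<open>One round follows any edge from \<open>v\<close> to \<open>c\<close> and returns along a
  unit that \<open>c\<close> receives under the fixed \<open>f\<close>. Only the vertices at even
  positions of the alternating path are collected, and earlier layers are kept.\<close>

fun alternating_reach :: "('a \<Rightarrow> 'a \<Rightarrow> nat) \<Rightarrow> 'a \<Rightarrow> nat \<Rightarrow> 'a set" where
  "alternating_reach f w 0 = {w}"
| "alternating_reach f w (Suc n) = alternating_reach f w n \<union>
     {u. \<exists>v\<in>alternating_reach f w n. \<exists>c. (v, c) \<in> E \<and> 0 < f u c}"

text \<open>
  Shifting units towards a vertex of a new layer only alters \<open>f\<close> on that vertex and on earlier layers,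
  so the arcs to later layers stay available.
\<close>

lemma alternating_reach_deficient:
  assumes f: "maximal f" and w: "deficient f w" and "u \<in> alternating_reach f w n"
  shows "\<exists>g. maximal g \<and> deficient g u \<and> load g = load f \<and>
           (\<forall>x. x \<notin> alternating_reach f w n \<longrightarrow> g x = f x)"
  using assms(3)
proof (induction n arbitrary: u)
  case 0
  then show ?case using f w by auto
next
  case (Suc n)
  show ?case
  proof (cases "u \<in> alternating_reach f w n")
    case True
    from Suc.IH[OF this] show ?thesis by auto
  next
    case False
    with Suc.prems obtain v c where vc: "v \<in> alternating_reach f w n" "(v, c) \<in> E" "0 < f u c"
      by auto
    from Suc.IH[OF vc(1)] obtain g where g: "maximal g" "deficient g v" "load g = load f"
      "\<forall>x. x \<notin> alternating_reach f w n \<longrightarrow> g x = f x" by blast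
    \<comment> \<open>The vertex \<open>u\<close> was not reached within \<open>n\<close> rounds, so
      \<open>g\<close> agrees with \<open>f\<close> on its row, whereas \<open>v\<close> was
      reached.\<close>
    have "0 < g u c" "u \<noteq> v" using g False vc by auto
    from maximal_shift[OF g(1,2) vc(2) this] obtain g' where
      "maximal g'" "deficient g' u" "load g' = load g" "\<And>x. x \<noteq> u \<Longrightarrow> x \<noteq> v \<Longrightarrow> g' x = g x" by blast
    moreover have "x \<noteq> u \<and> x \<noteq> v" if "x \<notin> alternating_reach f w (Suc n)" for x
      using that vc Suc.prems by auto
    ultimately show ?thesis using g by (intro exI[of _ g']) auto
  qed
qed

text \<open>Every reached vertex is deficient for some maximal assignment with the same loads. Hence
  it has load 0 and all its neighbours are full, which makes \<open>I\<close> independent. Givers to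
  a neighbour of \<open>I\<close> are reached one round later, so all units received by the
  neighbourhood come from \<open>I\<close>, and double counting gives the inequality.\<close>

lemma deficient_imp_hall_violation:
  assumes f: "maximal f" and w: "deficient f w"
  obtains I where "I \<subseteq> V" "I \<noteq> {}" "\<And>u v. u \<in> I \<Longrightarrow> v \<in> I \<Longrightarrow> (u, v) \<notin> E"
    "(2 * k + 1) * card (E `` I) < 2 * card I"
proof
  define I where "I = (\<Union>n. alternating_reach f w n)"
  have vf: "valid f" using f by (simp add: maximal_def)
  have I: "v \<in> V \<and> load f v = 0 \<and> (\<forall>c. (v, c) \<in> E \<longrightarrow> load f c = 2 * k + 1)" if vI: "v \<in> I" for v
  proof -
    obtain n where "v \<in> alternating_reach f w n" using vI by (auto simp: I_def)
    from alternating_reach_deficient[OF f w this] obtain g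
      where g: "maximal g" "deficient g v" "load g = load f" by blast
    then show ?thesis using maximal_saturated[OF g(1,2)] by (auto simp: deficient_def)
  qed
  show IV: "I \<subseteq> V" using I by blast
  have wI: "w \<in> I" unfolding I_def using alternating_reach.simps(1) by blast
  then show "I \<noteq> {}" by blast
  show "(u, v) \<notin> E" if "u \<in> I" "v \<in> I" for u v using I[OF that(1)] I[OF that(2)] by auto
  have finI: "finite I" using IV finite_V finite_subset by blast
  have S: "E `` I \<subseteq> V" using E_sub by auto
  have closed: "u \<in> I" if c: "c \<in> E `` I" and u: "0 < f u c" for u c
  proof -
    obtain v n where "v \<in> alternating_reach f w n" "(v, c) \<in> E" using c by (auto simp: I_def)
    then have "u \<in> alternating_reach f w (Suc n)" using u by auto
    then show ?thesis unfolding I_def by blast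
  qed
  have "(2 * k + 1) * card (E `` I) = (\<Sum>c\<in>E `` I. load f c)"
    using I by (subst sum.cong[where h = "\<lambda>_. 2 * k + 1"]) auto
  also have "\<dots> = (\<Sum>c\<in>E `` I. \<Sum>v\<in>I. f v c)"
    unfolding load_def using closed IV finite_V
    by (intro sum.cong refl sum.mono_neutral_right) auto
  also have "\<dots> = (\<Sum>v\<in>I. \<Sum>c\<in>E `` I. f v c)" by (rule sum.swap)
  also have "\<dots> \<le> (\<Sum>v\<in>I. units f v)"
    unfolding units_def using S finite_V by (intro sum_mono sum_mono2) auto
  \<comment> \<open>Strict because \<open>w\<close> itself belongs to \<open>I\<close> and gives at
    most one unit.\<close>
  also have "\<dots> < (\<Sum>v\<in>I. 2)"
    using finI wI w valid_units[OF vf]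
    by (intro sum_strict_mono_ex1) (auto simp: deficient_def intro!: bexI[of _ w])
  finally show "(2 * k + 1) * card (E `` I) < 2 * card I" by simp
qed

definition complete :: "('a \<Rightarrow> 'a \<Rightarrow> nat) \<Rightarrow> bool" where
  "complete f \<longleftrightarrow> valid f \<and> (\<forall>v\<in>V. 0 < load f v \<or> units f v = 2)"

text \<open>A maximal assignment works: a deficient vertex would produce an independent set
  violating \<open>hall\<close>.\<close>

lemma ex_complete:
  assumes hall: "\<And>I. I \<subseteq> V \<Longrightarrow> I \<noteq> {} \<Longrightarrow> (\<And>u v. u \<in> I \<Longrightarrow> v \<in> I \<Longrightarrow> (u, v) \<notin> E)
    \<Longrightarrow> 2 * card I \<le> (2 * k + 1) * card (E `` I)"
  shows "\<exists>f. complete f"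
proof -
  obtain f where f: "maximal f" using ex_maximal by blast
  have "\<not> deficient f w" for w
  proof
    assume "deficient f w"
    from deficient_imp_hall_violation[OF f this] obtain I where "I \<subseteq> V" "I \<noteq> {}"
      "\<And>u v. u \<in> I \<Longrightarrow> v \<in> I \<Longrightarrow> (u, v) \<notin> E" "(2 * k + 1) * card (E `` I) < 2 * card I" by metis
    with hall[of I] show False by auto
  qed
  moreover have vf: "valid f" using f by (simp add: maximal_def)
  ultimately have "0 < load f v \<or> units f v = 2" if "v \<in> V" for v
    using that valid_units[OF vf, of v] by (fastforce simp: deficient_def)
  with vf have "complete f" by (simp add: complete_def)
  then show ?thesis by blast
qed

section \<open>Few doubles\<close>

text \<open>If \<open>f\<close> is complete, a satellite gives both units to one center or one unit
  to each of two. In the first case this set is empty, in the second it has exactly two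
  elements.\<close>

definition hubs :: "('a \<Rightarrow> 'a \<Rightarrow> nat) \<Rightarrow> 'a \<Rightarrow> 'a set" where
  "hubs f v = {c. f v c = 1}"

definition doubles :: "('a \<Rightarrow> 'a \<Rightarrow> nat) \<Rightarrow> 'a set" where
  "doubles f = {v. hubs f v \<noteq> {}}"

definition minimal :: "('a \<Rightarrow> 'a \<Rightarrow> nat) \<Rightarrow> bool" where
  "minimal f \<longleftrightarrow> complete f \<and> (\<forall>g. complete g \<longrightarrow> card (doubles f) \<le> card (doubles g))"

lemma ex_minimal: "complete f \<Longrightarrow> \<exists>g. minimal g"
  unfolding minimal_def by (rule ex_has_least_nat)

lemma
  assumes "complete f"
  shows complete_valid: "valid f"
    and complete_units: "v \<in> V \<Longrightarrow> load f v = 0 \<Longrightarrow> units f v = 2"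
  using assms by (auto simp: complete_def)

lemma valid_in_V: "valid f \<Longrightarrow> 0 < f v c \<Longrightarrow> v \<in> V \<and> c \<in> V"
  by (rule E_in_V[OF valid_edge])

lemma satellite_units:
  assumes "complete f" "0 < f v c"
  shows "load f v = 0" "units f v = 2"
proof -
  note vf = complete_valid[OF assms(1)]
  have "0 < units f v" using valid_le_units[OF vf, of v c] assms(2) by simp
  then show l: "load f v = 0" using valid_center[OF vf, of v] by (cases "load f v") auto
  show "units f v = 2" using complete_units[OF assms(1) _ l] valid_in_V[OF vf assms(2)] by simp
qed

lemma single_row:
  assumes f: "complete f" and c: "f v c = 2"
  shows "f v x = (if x = c then 2 else 0)"
proof -
  note vf = complete_valid[OF f]
  have cV: "c \<in> V" using valid_in_V[OF vf, of v c] c by simp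
  have "units f v = 2" using satellite_units[OF f, of v c] c by simp
  then have "(\<Sum>y\<in>V - {c}. f v y) = 0"
    using c cV finite_V by (simp add: units_def sum.remove)
  then have "\<forall>y\<in>V - {c}. f v y = 0" using finite_V by simp
  then show ?thesis using c valid_in_V[OF vf, of v x] by (cases "f v x = 0") auto
qed

lemma double_row:
  assumes f: "complete f" and c: "f v c = 1"
  obtains d where "d \<noteq> c" "f v = (\<lambda>x. if x = c \<or> x = d then 1 else 0)"
proof -
  note vf = complete_valid[OF f]
  have cV: "c \<in> V" using valid_in_V[OF vf, of v c] c by simp
  have "units f v = 2" using satellite_units[OF f, of v c] c by simp
  then have "(\<Sum>y\<in>V - {c}. f v y) = 1"
    using c cV finite_V by (simp add: units_def sum.remove)
  moreover have "finite (V - {c})" using finite_V by simp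
  ultimately have "\<exists>d\<in>V - {c}. f v d = 1 \<and> (\<forall>y\<in>V - {c}. d \<noteq> y \<longrightarrow> f v y = 0)"
    by (simp only: sum_eq_1_iff)
  then obtain d where d: "d \<in> V - {c}" "f v d = 1" "\<forall>y\<in>V - {c}. d \<noteq> y \<longrightarrow> f v y = 0" by blast
  show thesis
  proof (rule that)
    show "f v = (\<lambda>x. if x = c \<or> x = d then 1 else 0)"
    proof
      fix x show "f v x = (if x = c \<or> x = d then 1 else 0)"
        using c d valid_in_V[OF vf, of v x] by (cases "f v x = 0") auto
    qed
  qed (use d in auto)
qed

lemma hubs_eq:
  assumes f: "complete f" and "f v c = 1" "f v d = 1" "c \<noteq> d"
  shows "hubs f v = {c, d}" "f v x = (if x = c \<or> x = d then 1 else 0)"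
proof -
  obtain d' where "d' \<noteq> c" and r: "f v = (\<lambda>x. if x = c \<or> x = d' then 1 else 0)"
    using double_row[OF f assms(2)] .
  then have d': "d' = d" using assms by (auto split: if_splits)
  show "f v x = (if x = c \<or> x = d then 1 else 0)" unfolding r d' ..
  show "hubs f v = {c, d}" unfolding hubs_def r d' by auto
qed

lemma doubles_in_V:
  assumes "complete f"
  shows "doubles f \<subseteq> V"
proof
  fix v assume "v \<in> doubles f"
  then obtain c where "f v c = 1" by (auto simp: doubles_def hubs_def)
  then show "v \<in> V" using valid_in_V[OF complete_valid[OF assms], of v c] by simp
qed

lemma finite_doubles: "complete f \<Longrightarrow> finite (doubles f)"
  by (rule finite_subset[OF doubles_in_V finite_V])

lemma minimal_not_psubset:
  assumes "minimal f" "complete g"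
  shows "\<not> doubles g \<subset> doubles f"
proof
  assume "doubles g \<subset> doubles f"
  then have "card (doubles g) < card (doubles f)"
    using assms finite_doubles by (intro psubset_card_mono) (auto simp: minimal_def)
  then show False using assms by (auto simp: minimal_def dest: leD)
qed

text \<open>If \<open>x\<close> had room, \<open>m\<close> could be removed from the doubles.
  Normally \<open>m\<close> gives both units to \<open>x\<close>. This would uncover its other hub
  \<open>y\<close> when \<open>y\<close> receives nothing but the unit of \<open>m\<close>; in that
  case \<open>m\<close> is promoted and \<open>y\<close> becomes its satellite. Either way no new
  double arises, against minimality.\<close>

lemma minimal_saturated:
  assumes f: "minimal f" and x: "f m x = 1"
  shows "load f x = 2 * k + 1"
proof (rule ccontr)
  assume ne: "load f x \<noteq> 2 * k + 1"
  have cf: "complete f" using f by (simp add: minimal_def)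
  note vf = complete_valid[OF cf]
  obtain y where y: "y \<noteq> x" and row: "f m = (\<lambda>c. if c = x \<or> c = y then 1 else 0)"
    using double_row[OF cf x] .
  have fmy: "f m y = 1" by (simp add: row)
  have mV: "m \<in> V" "x \<in> V" "y \<in> V" using valid_in_V[OF vf, of m x] valid_in_V[OF vf, of m y] x fmy by auto
  have lm: "load f m = 0" "units f m = 2" using satellite_units[OF cf, of m x] x by auto
  have md: "m \<in> doubles f" using x by (auto simp: doubles_def hubs_def)
  have ly: "1 \<le> load f y" using valid_le_load[OF vf, of m y] fmy by simp
  have lx: "load f x \<le> 2 * k" using ne valid_load[OF vf, of x] by simp
  have xs: "units f x = 0" using valid_center[OF vf, of x] valid_le_load[OF vf, of m x] x by simp
  show False
  proof (cases "load f y = 1")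
    case True
    let ?g = "promote f m"
    note pr = promote[OF vf mV(1) lm(1)]
    have yZ: "y \<in> robbed f m" using True fmy mV by (simp add: robbed_def)
    have "finite (robbed f m)" using finite_V by (simp add: robbed_def)
    then have "0 < load ?g m" using pr(3) yZ card_gt_0_iff[of "robbed f m"] by auto
    moreover have "0 < load ?g v" if "v \<noteq> m" "v \<notin> robbed f m" "0 < load f v" for v
    proof -
      have "load f v \<noteq> f m v"
      proof
        assume eq: "load f v = f m v"
        with that have "v \<in> V" using valid_in_V[OF vf, of m v] by simp
        with eq that show False by (auto simp: robbed_def)
      qed
      then show ?thesis using pr(2)[OF that(1)] by linarith
    qed
    ultimately have "complete ?g"
      using pr(1,4) cf unfolding complete_def by (metis (full_types) not_gr_zero)
    moreover have "doubles ?g \<subseteq> doubles f - {m}"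
      by (auto simp: doubles_def hubs_def promote_def split: if_splits)
    ultimately show False using minimal_not_psubset[OF f] md by blast
  next
    case False
    define g where "g = f(m := (\<lambda>c. if c = x then 2 else 0))"
    have lg: "load g c + f m c = load f c + (if c = x then 2 else 0)" for c
      unfolding g_def by (rule load_upd[OF mV(1)])
    have lgc: "load g c = (if c = x then load f x + 1 else if c = y then load f y - 1 else load f c)" for c
      using lg[of c] y by (auto simp: row split: if_splits)
    have ug: "units g c = units f c" for c
      using lm mV finite_V by (simp add: g_def units_upd)
    have "valid g" unfolding valid_def
    proof (intro conjI allI impI)
      fix v c assume "0 < g v c" then show "(v, c) \<in> E"
        using valid_edge[OF vf, of v c] x valid_edge[OF vf, of m x] by (auto simp: g_def split: if_splits)
    next
      fix c show "load g c \<le> 2 * k + 1" using lgc[of c] lx valid_load[OF vf, of c] by (auto split: if_splits)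
    next
      fix v show "units g v \<le> 2" using ug valid_units[OF vf] by simp
    next
      fix v assume "0 < load g v" then show "units g v = 0"
        using lgc[of v] ug[of v] xs valid_center[OF vf, of v] by (auto split: if_splits)
    qed
    moreover have "0 < load g v" if "0 < load f v" for v
      using lgc[of v] False ly that by auto
    ultimately have "complete g" using cf ug by (auto simp: complete_def)
    moreover have "doubles g \<subseteq> doubles f - {m}"
      by (auto simp: g_def doubles_def hubs_def split: if_splits)
    ultimately show False using minimal_not_psubset[OF f] md by blast
  qed
qed

lemma sum_inj_indicator:
  assumes "finite S" "inj_on p S"
  shows "(\<Sum>e\<in>S. if p e = c then 1 else 0) = (if c \<in> p ` S then 1 else (0::nat))"
proof -
  have "(\<Sum>x\<in>p ` S. if x = c then 1 else 0) = (\<Sum>e\<in>S. if p e = c then 1 else (0::nat))"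
    using assms(2) by (subst sum.reindex) auto
  then show ?thesis using assms(1) by simp
qed

text \<open>
  Along a cyclic set of pairs of centers, every double can be given entirely to the first of its
  two centers without changing any load.
\<close>

lemma minimal_no_rotation:
  fixes mid :: "'a \<times> 'a \<Rightarrow> 'a"
  assumes f: "minimal f" and S: "finite S" "S \<noteq> {}"
    and mid: "inj_on mid S" "\<And>a b. (a, b) \<in> S \<Longrightarrow> a \<noteq> b \<and> f (mid (a, b)) a = 1 \<and> f (mid (a, b)) b = 1"
    and inj: "inj_on fst S" "inj_on snd S" and cyc: "fst ` S = snd ` S"
  shows False
proof -
  have cf: "complete f" using f by (simp add: minimal_def)
  note vf = complete_valid[OF cf]
  define M where "M = mid ` S"
  \<comment> \<open>As \<open>mid\<close> is injective on \<open>S\<close>, each \<open>m\<close> in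
    \<open>M\<close> belongs to a unique pair, and \<open>p m\<close> is the first center of that
    pair.\<close>
  define p where "p = (\<lambda>m. fst (inv_into S mid m))"
  define g where "g = (\<lambda>v. if v \<in> M then (\<lambda>c. if c = p v then 2 else 0) else f v)"
  have p: "p (mid e) = fst e" if "e \<in> S" for e using that mid(1) by (simp add: p_def)
  have row: "f (mid e) c = (if fst e = c then 1 else 0) + (if snd e = c then 1 else 0)" if "e \<in> S" for e c
    using hubs_eq(2)[OF cf, of "mid e" "fst e" "snd e" c] mid(2)[of "fst e" "snd e"] that by auto
  have pE: "f m (p m) = 1" if "m \<in> M" for m using that mid(2) p by (force simp: M_def)
  have MV: "M \<subseteq> V"
  proof
    fix m assume "m \<in> M" then show "m \<in> V" using pE valid_in_V[OF vf, of m "p m"] by simp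
  qed
  have lg: "load g c = load f c" for c
  proof -
    have split: "load h c = (\<Sum>v\<in>V - M. h v c) + (\<Sum>e\<in>S. h (mid e) c)" for h :: "'a \<Rightarrow> 'a \<Rightarrow> nat"
      using MV finite_V mid(1) unfolding load_def M_def
      by (subst sum.subset_diff[of "mid ` S" V]) (auto simp: sum.reindex)
    have "(\<Sum>e\<in>S. g (mid e) c) = (\<Sum>e\<in>S. 2 * (if fst e = c then 1 else 0))"
      using p by (intro sum.cong) (auto simp: g_def M_def)
    also have "\<dots> = 2 * (\<Sum>e\<in>S. if fst e = c then 1 else 0)" by (simp only: sum_distrib_left)
    \<comment> \<open>First and second components run through the same centers, each once. So one of
      the two copies may be read as counting second components, which gives back the original
      contribution of the doubles.\<close>
    also have "\<dots> = (\<Sum>e\<in>S. if fst e = c then 1 else 0) + (\<Sum>e\<in>S. if snd e = c then 1 else 0)"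
      using sum_inj_indicator[OF S(1) inj(1), of c] sum_inj_indicator[OF S(1) inj(2), of c] cyc by simp
    also have "\<dots> = (\<Sum>e\<in>S. f (mid e) c)" using row by (simp add: sum.distrib)
    finally show ?thesis unfolding split by (simp add: g_def)
  qed
  have ug: "units g v = units f v" for v
  proof (cases "v \<in> M")
    case True
    have "p v \<in> V" using valid_in_V[OF vf, of v "p v"] pE[OF True] by simp
    then have "units g v = 2" using True finite_V by (simp add: g_def units_def)
    then show ?thesis using satellite_units(2)[OF cf, of v "p v"] pE[OF True] by simp
  qed (simp add: g_def units_def)
  have "(v, c) \<in> E" if "0 < g v c" for v c
    using that pE[of v] valid_edge[OF vf, of v c] by (auto simp: g_def split: if_splits)
  then have "complete g" using cf lg ug by (simp add: complete_def valid_def)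
  moreover have "doubles g \<subseteq> doubles f - M"
    by (auto simp: g_def doubles_def hubs_def split: if_splits)
  moreover have "M \<subseteq> doubles f" "M \<noteq> {}" using pE S by (auto simp: doubles_def hubs_def M_def)
  ultimately show False using minimal_not_psubset[OF f] by blast
qed

text \<open>Two doubles with the same two hubs would form the shortest cycle: from \<open>x\<close>
  to \<open>y\<close> through \<open>m\<close> and back through \<open>n\<close>.\<close>

lemma double_unique:
  assumes f: "minimal f" and "f m x = 1" "f m y = 1" "f n x = 1" "f n y = 1" "x \<noteq> y"
  shows "m = n"
proof (rule ccontr)
  assume "m \<noteq> n"
  then show False
    using assms(2-)
    by (intro minimal_no_rotation[OF f, where S = "{(x, y), (y, x)}"
          and mid = "\<lambda>e. if e = (x, y) then m else n"])
      (simp_all add: inj_on_def, blast+)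
qed

lemma load_eq:
  assumes f: "complete f"
  shows "load f x = 2 * card {v. f v x = 2} + card {v. f v x = 1}"
proof -
  note vf = complete_valid[OF f]
  have two: "f v x \<le> 2" for v using valid_le_units[OF vf, of v x] valid_units[OF vf, of v] by simp
  have sub: "{v. f v x = 2} \<subseteq> V" "{v. f v x = 1} \<subseteq> V" using valid_in_V[OF vf, of _ x] by auto
  have "load f x = (\<Sum>v\<in>V. 2 * (if f v x = 2 then 1 else 0) + (if f v x = 1 then 1 else 0))"
    unfolding load_def
  proof (intro sum.cong refl)
    fix v show "f v x = 2 * (if f v x = 2 then 1 else 0) + (if f v x = 1 then 1 else 0)"
      using two[of v] by auto
  qed
  also have "\<dots> = 2 * card (V \<inter> {v. f v x = 2}) + card (V \<inter> {v. f v x = 1})"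
    using finite_V by (simp add: sum.distrib sum_distrib_left[symmetric] sum.If_cases del: mult_2)
  finally show ?thesis using sub by (simp add: Int_absorb1)
qed

end

section \<open>Images, components and cycles of graphs\<close>

definition image_graph :: "('a \<Rightarrow> 'b) \<Rightarrow> 'a set \<Rightarrow> ('a \<times> 'a) set \<Rightarrow> 'b pair_pre_digraph" where
  "image_graph h X A = \<lparr> pverts = h ` X, parcs = map_prod h h ` A \<rparr>"

lemma image_graph_simps [simp]:
  "pverts (image_graph h X A) = h ` X"
  "parcs (image_graph h X A) = map_prod h h ` A"
  by (simp_all add: image_graph_def)

text \<open>Reduces membership of a component in the family, up to isomorphism, to an identity about
  its renamed copy.\<close>

lemma image_graph_iso:
  assumes "inj_on h X"
  shows "digraph_iso (with_proj F \<restriction> X) (with_proj (image_graph h X (parcs F \<inter> X \<times> X)))"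
proof -
  let ?G = "with_proj F \<restriction> X"
  let ?i = "\<lparr> iso_verts = h, iso_arcs = map_prod h h, iso_head = snd, iso_tail = fst \<rparr>"
  have arcs: "arcs ?G = parcs F \<inter> X \<times> X" by (auto simp: induce_subgraph_def)
  have "wf_digraph ?G" by unfold_locales auto
  moreover have "inj_on (map_prod h h) (arcs ?G)"
    unfolding arcs by (rule inj_on_subset[OF map_prod_inj_on[OF assms assms]]) simp
  ultimately have "pre_digraph.digraph_isomorphism ?G ?i"
    using assms by (simp add: pre_digraph.digraph_isomorphism_def induce_subgraph_def)
  moreover have "with_proj (image_graph h X (parcs F \<inter> X \<times> X)) = app_iso ?i ?G"
    using arcs by (simp add: app_iso_def with_proj_def image_graph_def)
  ultimately show ?thesis unfolding digraph_iso_def by blast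
qed

lemma pair_graphI:
  assumes "finite (pverts G)" "parcs G \<subseteq> pverts G \<times> pverts G" "sym (parcs G)" "\<And>x. (x, x) \<notin> parcs G"
  shows "pair_graph G"
proof -
  have "finite (parcs G)" using assms(1,2) finite_subset by blast
  then show ?thesis using assms by unfold_locales (auto simp: symmetric_def)
qed

text \<open>In a symmetric digraph every arc can be traversed back, so a strong component is closed
  under arcs.\<close>

lemma pair_graph_scc:
  assumes "pair_graph F" and C: "C \<in> pre_digraph.sccs (with_proj F)"
  obtains X where "C = with_proj F \<restriction> X" "X \<noteq> {}" "X \<subseteq> pverts F"
    "\<And>a b. a \<in> X \<Longrightarrow> (a, b) \<in> parcs F \<Longrightarrow> b \<in> X"
    "\<And>a b. a \<in> X \<Longrightarrow> b \<in> X \<Longrightarrow> (a, b) \<in> (parcs F)\<^sup>*"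
proof -
  interpret pair_graph F by fact
  from C obtain X where X: "C = with_proj F \<restriction> X" "X \<in> sccs_verts"
    using sccs_conv_sccs_verts by auto
  show thesis
  proof (rule that[OF X(1)])
    show "X \<noteq> {}" using X(2) by (simp add: sccs_verts_def)
    show "X \<subseteq> pverts F" using X(2) by (rule sccs_verts_subsets)
    show "(a, b) \<in> (parcs F)\<^sup>*" if "a \<in> X" "b \<in> X" for a b
      using X(2) that reachable_rtranclI[of "with_proj F" a b] by (simp add: sccs_verts_def)
    show "b \<in> X" if "a \<in> X" "(a, b) \<in> parcs F" for a b
    proof (rule ccontr)
      assume "b \<notin> X"
      with X(2) that have "\<not> reachable (with_proj F) a b \<or> \<not> reachable (with_proj F) b a"
        by (auto simp: sccs_verts_def)
      moreover have "reachable (with_proj F) a b" "reachable (with_proj F) b a"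
        using that(2) by (auto simp: arcs_symmetric)
      ultimately show False by blast
    qed
  qed
qed

lemma out_degree_eq_card:
  assumes "tail G = fst"
  shows "out_degree G v = card {w. (v, w) \<in> arcs G}"
proof -
  have "out_arcs G v = Pair v ` {w. (v, w) \<in> arcs G}" using assms by (auto simp: out_arcs_def)
  then show ?thesis by (simp add: out_degree_def card_image inj_on_def)
qed

text \<open>The cyclic successor on at least three positions has no 2-cycle. It serves to show that
  a cycle of length at least 3 does not use an edge in both directions.\<close>

lemma not_mod_two_cycle:
  fixes i j n :: nat
  assumes "i < n" "j < n" "3 \<le> n"
  shows "\<not> (Suc i mod n = j \<and> Suc j mod n = i)"
proof
  assume c: "Suc i mod n = j \<and> Suc j mod n = i"
  have "Suc i mod n = (if Suc i = n then 0 else Suc i)" "Suc j mod n = (if Suc j = n then 0 else Suc j)"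
    using assms by auto
  then show False using c assms by (cases "Suc i = n"; cases "Suc j = n") auto
qed

lemma pcas_cyclic_shift: "pcas u p v \<Longrightarrow> u # map snd p = map fst p @ [v]"
  by (induction p arbitrary: u) auto

text \<open>The arcs of the cycle themselves: each of its vertices is entered once and left once, so
  tails and heads are injective with the same range. This is the shape of input that
  \<open>minimal_no_rotation\<close> expects.\<close>

lemma long_cycle_arcs:
  assumes R: "pair_wf_digraph R" and p: "pre_digraph.cycle (with_proj R) p" "3 \<le> length p"
  obtains S where "S \<subseteq> parcs R" "finite S" "S \<noteq> {}" "inj_on fst S" "inj_on snd S" "fst ` S = snd ` S"
    "\<And>x y. (x, y) \<in> S \<Longrightarrow> (y, x) \<notin> S"
proof -
  interpret pair_wf_digraph R by fact
  from p obtain u where u: "awalk u p u" "distinct (tl (awalk_verts u p))" and ne: "p \<noteq> []"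
    by (auto simp: cycle_def)
  from u(1) have cas: "pcas u p u" and sub: "set p \<subseteq> parcs R" by (auto simp: awalk_def)
  have shift: "u # map snd p = map fst p @ [u]" using pcas_cyclic_shift[OF cas] .
  have "tl (awalk_verts u p) = map snd p"
    using awalk_verts_conv'[of u p u] cas ne by simp
  with u(2) have ds: "distinct (map snd p)" by simp
  \<comment> \<open>Since the walk is closed, the shift only permutes: the heads are the tails in
    another order.\<close>
  have "mset (u # map snd p) = mset (map fst p @ [u])" by (simp only: shift)
  then have ms: "mset (map snd p) = mset (map fst p)" by simp
  then have df: "distinct (map fst p)" using ds by (metis mset_eq_imp_distinct_iff)
  have succ: "fst (p ! (Suc i mod length p)) = snd (p ! i)" if "i < length p" for i
  proof (cases "Suc i < length p")
    case True
    then have "(u # map snd p) ! Suc i = snd (p ! i)" "(map fst p @ [u]) ! Suc i = fst (p ! Suc i)"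
      by (auto simp: nth_append)
    with True shift show ?thesis by simp
  next
    case False
    then have i: "Suc i = length p" using that by simp
    have "(u # map snd p) ! Suc i = snd (p ! i)" using that by simp
    moreover have "(map fst p @ [u]) ! Suc i = u" using i by (simp add: nth_append)
    moreover have "fst (p ! 0) = u" using cas ne by (cases p) auto
    ultimately show ?thesis using i shift by simp
  qed
  show thesis
  proof (rule that[OF sub])
    show "finite (set p)" "set p \<noteq> {}" using ne by auto
    show "inj_on fst (set p)" "inj_on snd (set p)" using df ds by (auto simp: distinct_map)
    show "fst ` set p = snd ` set p" using ms by (metis set_map set_mset_mset)
    show "(y, x) \<notin> set p" if xy: "(x, y) \<in> set p" for x y
    proof
      assume "(y, x) \<in> set p"
      with xy obtain i j where ij: "i < length p" "p ! i = (x, y)" "j < length p" "p ! j = (y, x)"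
        by (auto simp: in_set_conv_nth)
      have inj: "a = b" if "fst (p ! a) = fst (p ! b)" "a < length p" "b < length p" for a b
        using df that by (auto simp: distinct_conv_nth)
      have lt: "Suc a mod length p < length p" for a using ne by simp
      have "snd (p ! i) = fst (p ! j)" "snd (p ! j) = fst (p ! i)" using ij(2,4) by simp_all
      then have "Suc i mod length p = j" "Suc j mod length p = i"
        using inj[OF _ lt ij(3)] inj[OF _ lt ij(1)] succ[OF ij(1)] succ[OF ij(3)] by metis+
      then show False using not_mod_two_cycle[OF ij(1,3) p(2)] by blast
    qed
  qed
qed

section \<open>Components without doubles\<close>

context finite_graph
begin

definition factor :: "('a \<Rightarrow> 'a \<Rightarrow> nat) \<Rightarrow> 'a pair_pre_digraph" where
  "factor f = \<lparr> pverts = V, parcs = {(a, b). 0 < f a b \<or> 0 < f b a} \<rparr>"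

lemma factor_simps [simp]:
  "pverts (factor f) = V"
  "(a, b) \<in> parcs (factor f) \<longleftrightarrow> 0 < f a b \<or> 0 < f b a"
  by (simp_all add: factor_def)

lemma factor_subset: "valid f \<Longrightarrow> parcs (factor f) \<subseteq> E"
  using valid_edge E_sym by (auto simp: factor_def)

lemma pair_graph_factor:
  assumes "valid f"
  shows "pair_graph (factor f)"
proof (rule pair_graphI)
  show "parcs (factor f) \<subseteq> pverts (factor f) \<times> pverts (factor f)"
    using factor_subset[OF assms] E_sub by auto
  show "(x, x) \<notin> parcs (factor f)" for x using factor_subset[OF assms] E_irrefl by blast
qed (use finite_V in \<open>auto simp: sym_def\<close>)

text \<open>The properties delivered by \<open>pair_graph_scc\<close>, stated for
  \<open>factor f\<close>.\<close>

definition component :: "('a \<Rightarrow> 'a \<Rightarrow> nat) \<Rightarrow> 'a set \<Rightarrow> bool" where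
  "component f X \<longleftrightarrow> X \<noteq> {} \<and> X \<subseteq> V \<and> (\<forall>a\<in>X. \<forall>b. (a, b) \<in> parcs (factor f) \<longrightarrow> b \<in> X) \<and>
     (\<forall>a\<in>X. \<forall>b\<in>X. (a, b) \<in> (parcs (factor f))\<^sup>*)"

lemma component_closed: "component f X \<Longrightarrow> a \<in> X \<Longrightarrow> 0 < f a b \<or> 0 < f b a \<Longrightarrow> b \<in> X"
  unfolding component_def factor_simps(2) by blast

text \<open>A path inside the component cannot leave the arc-closed set \<open>Y\<close>. This
  bounds components from above and spreads properties over them.\<close>

lemma component_subset:
  assumes X: "component f X" and "a \<in> X" "a \<in> Y"
    and Y: "\<And>x y. x \<in> Y \<Longrightarrow> 0 < f x y \<or> 0 < f y x \<Longrightarrow> y \<in> Y"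
  shows "X \<subseteq> Y"
proof
  fix b assume "b \<in> X"
  then have "(a, b) \<in> (parcs (factor f))\<^sup>*" using X \<open>a \<in> X\<close> unfolding component_def by blast
  then show "b \<in> Y"
  proof (induction rule: rtrancl_induct)
    case base show ?case by fact
  next
    case (step x y) then show ?case using Y[of x y] by simp
  qed
qed

lemma satellite_not_center:
  assumes f: "complete f" and c: "0 < f v c"
  shows "f w v = 0"
  using satellite_units(1)[OF f c] valid_le_load[OF complete_valid[OF f], of w v] by simp

lemma satellite_values:
  assumes f: "complete f" and c: "0 < f v c"
  shows "f v c = 1 \<or> f v c = 2"
  using satellite_units(2)[OF f c] valid_le_units[OF complete_valid[OF f], of v c] c by linarith

lemma ex_hub:
  assumes f: "complete f" and v: "v \<in> V" "load f v = 0"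
  obtains c where "0 < f v c"
proof -
  have "units f v \<noteq> 0" using complete_units[OF f v] by simp
  then obtain c where "f v c \<noteq> 0"
    unfolding units_def using sum.not_neutral_contains_not_neutral by blast
  then show thesis using that by simp
qed

lemma component_center:
  assumes f: "complete f" and X: "component f X"
  obtains c where "c \<in> X" "0 < load f c"
proof -
  obtain a where a: "a \<in> X" "a \<in> V" using X unfolding component_def by blast
  show thesis
  proof (cases "0 < load f a")
    case True then show thesis using that a by blast
  next
    case False
    with ex_hub[OF f a(2)] obtain c where c: "0 < f a c" by auto
    then have "0 < load f c" using valid_le_load[OF complete_valid[OF f], of a c] by simp
    then show thesis using that component_closed[OF X a(1), of c] c by blast
  qed
qed

text \<open>Without doubles, every satellite of the center \<open>c\<close> gives both units to
  \<open>c\<close>, so \<open>c\<close> and its satellites are closed under arcs and fill the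
  component. The load of \<open>c\<close> is then twice the number of leaves.\<close>

lemma star_component:
  assumes f: "complete f" and X: "component f X" and nd: "X \<inter> doubles f = {}" and h: "inj_on h X"
  shows "image_graph h X (parcs (factor f) \<inter> X \<times> X) \<in> stars_upto k"
proof -
  obtain c where c: "c \<in> X" "0 < load f c" using component_center[OF f X] .
  note vf = complete_valid[OF f]
  define L where "L = {v. f v c = 2}"
  have fc: "f c x = 0" for x
    using valid_center[OF vf c(2)] valid_le_units[OF vf, of c x] by simp
  have no1: "f v x \<noteq> 1" if "v \<in> X" for v x using nd that by (auto simp: doubles_def hubs_def)
  have L2: "f v c = 2" if "0 < f v c" for v
    using satellite_values[OF f that] no1[of v c] component_closed[OF X c(1), of v] that by auto
  have LX: "L \<subseteq> X" using component_closed[OF X c(1)] by (auto simp: L_def)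
  have row: "f v x = (if x = c then 2 else 0)" if "v \<in> L" for v x
    using single_row[OF f, of v c x] that by (simp add: L_def)
  have col: "f x v = 0" if "v \<in> L" for x v
    using satellite_not_center[OF f, of v c x] that by (simp add: L_def)
  have "X \<subseteq> insert c L"
  proof (rule component_subset[OF X c(1)])
    fix x y assume x: "x \<in> insert c L" and xy: "0 < f x y \<or> 0 < f y x"
    show "y \<in> insert c L"
    proof (cases "x = c")
      case True
      then have "0 < f y c" using xy fc by simp
      then show ?thesis using L2 by (simp add: L_def)
    next
      case False
      then have "x \<in> L" using x by simp
      then show ?thesis using xy row[of x y] col[of x y] by (auto split: if_splits)
    qed
  qed simp
  with LX c have XL: "X = insert c L" by blast
  have cL: "c \<notin> L" using fc by (simp add: L_def)
  have finL: "finite L" using LX X finite_V finite_subset unfolding component_def by metis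
  have "f v c \<noteq> 1" for v using L2[of v] by linarith
  then have "load f c = 2 * card L" using load_eq[OF f, of c] by (simp add: L_def)
  \<comment> \<open>From \<open>2 * card L\<close> being positive and at most
    \<open>2 * k + 1\<close>, an even number being at most \<open>2 * k\<close>.\<close>
  then have card: "card L \<in> {1..k}" using c valid_load[OF vf, of c] by auto
  have adj: "0 < f a b \<or> 0 < f b a \<longleftrightarrow> a = c \<and> b \<in> L \<or> a \<in> L \<and> b = c" if "a \<in> X" "b \<in> X" for a b
    using that cL unfolding XL by (auto simp: fc row col split: if_splits)
  have arcs: "parcs (factor f) \<inter> X \<times> X = {c} \<times> L \<union> L \<times> {c}"
    using XL adj by (auto simp: factor_def row)
  have "map_prod h h ` ({c} \<times> L \<union> L \<times> {c}) = {h c} \<times> h ` L \<union> h ` L \<times> {h c}" by force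
  moreover have "h c \<notin> h ` L" "card (h ` L) = card L"
    using h cL unfolding XL by (auto intro: card_image)
  ultimately have "complete_bipartite_digraph 1 (card L)
      (with_proj (image_graph h X (parcs (factor f) \<inter> X \<times> X)))"
    unfolding complete_bipartite_digraph_pair_def arcs
    using finL by (intro conjI exI[of _ "{h c}"] exI[of _ "h ` L"]) (simp_all add: XL)
  with card show ?thesis by (auto simp: stars_upto_def)
qed

text \<open>Fullness spreads from a double: both hubs of a double are full by
  \<open>minimal_saturated\<close>, and a satellite giving two units has only one center. So the
  full centers together with the vertices giving to them are closed under arcs.\<close>

lemma tree_component_saturated:
  assumes f: "minimal f" and X: "component f X" and d: "X \<inter> doubles f \<noteq> {}"
    and x: "x \<in> X" "0 < load f x"
  shows "load f x = 2 * k + 1"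
proof -
  have cf: "complete f" using f by (simp add: minimal_def)
  define Y where "Y = {x. load f x = 2 * k + 1} \<union> {v. \<exists>c. 0 < f v c \<and> load f c = 2 * k + 1}"
  obtain m c where m: "m \<in> X" "f m c = 1" using d by (auto simp: doubles_def hubs_def)
  have "m \<in> Y" using minimal_saturated[OF f m(2)] m by (auto simp: Y_def intro!: exI[of _ c])
  moreover have "b \<in> Y" if a: "a \<in> Y" and ab: "0 < f a b \<or> 0 < f b a" for a b
  proof (cases "load f a = 2 * k + 1")
    case True
    then have "0 < f b a" using ab satellite_units(1)[OF cf, of a b] by auto
    then show ?thesis using True by (auto simp: Y_def)
  next
    case False
    then obtain c where c: "0 < f a c" "load f c = 2 * k + 1" using a by (auto simp: Y_def)
    have fab: "0 < f a b" using ab satellite_not_center[OF cf c(1), of b] by simp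
    have "load f b = 2 * k + 1"
    proof (cases "f a b = 1")
      case True then show ?thesis using minimal_saturated[OF f] by blast
    next
      case False
      then have "f a b = 2" using satellite_values[OF cf fab] by simp
      then have "c = b" using single_row[OF cf, of a b c] c by (auto split: if_splits)
      then show ?thesis using c by simp
    qed
    then show ?thesis by (simp add: Y_def)
  qed
  ultimately have "X \<subseteq> Y" using component_subset[OF X m(1)] by blast
  with x have "x \<in> Y" by blast
  then show ?thesis using satellite_units(1)[OF cf, of x] x by (auto simp: Y_def)
qed

end

section \<open>Components with doubles\<close>

text \<open>The injection \<open>h\<close> renames vertices; it will take values in the natural
  numbers, on which the trees of the family live.\<close>

locale tree_component = finite_graph V E k
  for V :: "'a set" and E :: "('a \<times> 'a) set" and k :: nat +
  fixes f :: "'a \<Rightarrow> 'a \<Rightarrow> nat" and X :: "'a set" and h :: "'a \<Rightarrow> 'b"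
  assumes f_minimal: "minimal f"
    and X_component: "component f X"
    and X_double: "X \<inter> doubles f \<noteq> {}"
    and h_inj: "inj_on h V"
begin

lemma f_complete: "complete f"
  using f_minimal by (simp add: minimal_def)

lemmas f_valid = complete_valid[OF f_complete]

lemma X_sub: "X \<subseteq> V"
  using X_component unfolding component_def by blast

lemma closed: "a \<in> X \<Longrightarrow> 0 < f a b \<Longrightarrow> b \<in> X"
  and closed': "a \<in> X \<Longrightarrow> 0 < f b a \<Longrightarrow> b \<in> X"
  using component_closed[OF X_component] by blast+

section \<open>Centers, pendant vertices and the links between them\<close>

definition centers :: "'a set" where "centers = {x \<in> X. 0 < load f x}"

definition pendants :: "'a set" where "pendants = {v \<in> X. \<exists>x. f v x = 2}"

definition hub_link :: "('a \<times> 'a) set" where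
  "hub_link = {(x, y). x \<in> X \<and> x \<noteq> y \<and> (\<exists>m. f m x = 1 \<and> f m y = 1)}"

definition pendant_link :: "('a \<times> 'a) set" where
  "pendant_link = {(v, x). v \<in> X \<and> f v x = 2}"

definition links :: "('a \<times> 'a) set" where
  "links = hub_link \<union> pendant_link \<union> pendant_link\<inverse>"

text \<open>On \<open>hub_link\<close> the choice is unique by \<open>double_unique\<close>.\<close>

definition mid :: "'a \<times> 'a \<Rightarrow> 'a" where
  "mid e = (SOME m. f m (fst e) = 1 \<and> f m (snd e) = 1)"

lemma pos_load: "0 < f v c \<Longrightarrow> 0 < load f c"
  using valid_le_load[OF f_valid, of v c] by linarith

lemma center_row: "x \<in> centers \<Longrightarrow> f x y = 0"
  using valid_center[OF f_valid, of x] valid_le_units[OF f_valid, of x y] by (simp add: centers_def)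

lemma centers_I: "c \<in> X \<Longrightarrow> 0 < f v c \<Longrightarrow> c \<in> centers"
  using pos_load by (simp add: centers_def)

lemma centers_pendants: "centers \<inter> pendants = {}"
  using center_row by (auto simp: pendants_def)

lemma X_minus_doubles: "X - doubles f = centers \<union> pendants"
proof
  show "X - doubles f \<subseteq> centers \<union> pendants"
  proof
    fix v assume v: "v \<in> X - doubles f"
    show "v \<in> centers \<union> pendants"
    proof (cases "load f v = 0")
      case True
      obtain c where c: "0 < f v c" using ex_hub[OF f_complete _ True] v X_sub by blast
      have "f v c \<noteq> 1" using v by (auto simp: doubles_def hubs_def)
      then show ?thesis using satellite_values[OF f_complete c] v by (auto simp: pendants_def)
    qed (use v in \<open>simp add: centers_def\<close>)
  qed
  have "v \<notin> doubles f" if "v \<in> centers" for v using center_row[OF that] by (auto simp: doubles_def hubs_def)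
  moreover have "v \<notin> doubles f" if v: "v \<in> pendants" for v
  proof -
    obtain x where "f v x = 2" using v by (auto simp: pendants_def)
    from single_row[OF f_complete this] show ?thesis by (auto simp: doubles_def hubs_def)
  qed
  ultimately show "centers \<union> pendants \<subseteq> X - doubles f" by (auto simp: centers_def pendants_def)
qed

lemma hub_link_centers: "(x, y) \<in> hub_link \<Longrightarrow> x \<in> centers \<and> y \<in> centers \<and> x \<noteq> y"
proof -
  assume "(x, y) \<in> hub_link"
  then obtain m where m: "x \<in> X" "x \<noteq> y" "f m x = 1" "f m y = 1" by (auto simp: hub_link_def)
  have "m \<in> X" using closed'[of x m] m by simp
  then have "y \<in> X" using closed[of m y] m by simp
  then show ?thesis using centers_I[of x m] centers_I[of y m] m by simp
qed

lemma hub_link_I: "x \<in> X \<Longrightarrow> f m x = 1 \<Longrightarrow> f m y = 1 \<Longrightarrow> x \<noteq> y \<Longrightarrow> (x, y) \<in> hub_link"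
  unfolding hub_link_def by blast

lemma sym_hub_link: "(x, y) \<in> hub_link \<Longrightarrow> (y, x) \<in> hub_link"
  using hub_link_centers[of x y] unfolding hub_link_def centers_def by blast

lemma pendant_link_D: "(v, x) \<in> pendant_link \<Longrightarrow> v \<in> pendants \<and> x \<in> centers \<and> f v x = 2"
  using centers_I[of x v] closed[of v x] by (auto simp: pendant_link_def pendants_def)

lemma pendant_link_unique: "(v, x) \<in> pendant_link \<Longrightarrow> (v, y) \<in> pendant_link \<Longrightarrow> x = y"
  using single_row[OF f_complete, of v x y] by (auto simp: pendant_link_def split: if_splits)

lemma links_sub: "links \<subseteq> (centers \<union> pendants) \<times> (centers \<union> pendants)"
  by (auto simp: links_def dest: hub_link_centers pendant_link_D)

lemma sym_links: "(x, y) \<in> links \<Longrightarrow> (y, x) \<in> links"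
  using sym_hub_link unfolding links_def by blast

lemma links_irrefl: "(x, x) \<notin> links"
  using hub_link_centers[of x x] pendant_link_D[of x x] centers_pendants unfolding links_def by blast

lemma links_centers: "(x, y) \<in> links \<and> x \<in> centers \<and> y \<in> centers \<longleftrightarrow> (x, y) \<in> hub_link"
  using hub_link_centers[of x y] pendant_link_D[of x y] pendant_link_D[of y x] centers_pendants
  unfolding links_def by blast

lemma links_pendant:
  assumes "(v, x) \<in> pendant_link"
  shows "(v, y) \<in> links \<longleftrightarrow> y = x" and "(y, v) \<in> links \<longleftrightarrow> y = x"
proof -
  show *: "(v, y) \<in> links \<longleftrightarrow> y = x" for y
    using assms pendant_link_D[OF assms] hub_link_centers[of v y] pendant_link_D[of y v] centers_pendants
      pendant_link_unique[OF assms, of y]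
    unfolding links_def by blast
  show "(y, v) \<in> links \<longleftrightarrow> y = x" using * sym_links by blast
qed

lemma mid:
  assumes "(x, y) \<in> hub_link"
  shows "f (mid (x, y)) x = 1" "f (mid (x, y)) y = 1" "hubs f (mid (x, y)) = {x, y}"
proof -
  have "\<exists>m. f m x = 1 \<and> f m y = 1" using assms by (auto simp: hub_link_def)
  then have *: "f (mid (x, y)) x = 1 \<and> f (mid (x, y)) y = 1"
    unfolding mid_def fst_conv snd_conv by (rule someI_ex)
  then show "f (mid (x, y)) x = 1" "f (mid (x, y)) y = 1" by auto
  show "hubs f (mid (x, y)) = {x, y}"
    using hubs_eq(1)[OF f_complete, of "mid (x, y)" x y] * hub_link_centers[OF assms] by blast
qed

text \<open>The map from \<open>y\<close> to the double between \<open>x\<close> and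
  \<open>y\<close> is a bijection: its hubs recover \<open>y\<close>, and by
  \<open>double_unique\<close> every double at \<open>x\<close> is obtained.\<close>

lemma card_hub_link:
  assumes x: "x \<in> centers"
  shows "card {y. (x, y) \<in> hub_link} = card {m. f m x = 1}"
proof (rule bij_betw_same_card)
  show "bij_betw (\<lambda>y. mid (x, y)) {y. (x, y) \<in> hub_link} {m. f m x = 1}"
  proof (rule bij_betwI')
    fix y z assume "y \<in> {y. (x, y) \<in> hub_link}" "z \<in> {y. (x, y) \<in> hub_link}"
    then show "mid (x, y) = mid (x, z) \<longleftrightarrow> y = z"
      using mid(3)[of x y] mid(3)[of x z] by (auto simp: doubleton_eq_iff)
  next
    fix m assume "m \<in> {m. f m x = 1}"
    then have m: "f m x = 1" by simp
    obtain d where d: "d \<noteq> x" "f m = (\<lambda>c. if c = x \<or> c = d then 1 else 0)"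
      using double_row[OF f_complete m] .
    then have md: "f m d = 1" by simp
    have l: "(x, d) \<in> hub_link" using hub_link_I[of x m d] m md d x by (auto simp: centers_def)
    have "m = mid (x, d)"
      using double_unique[OF f_minimal m md mid(1,2)[OF l]] d by blast
    then show "\<exists>y\<in>{y. (x, y) \<in> hub_link}. m = mid (x, y)" using l by blast
  qed (use mid in auto)
qed

text \<open>The identity \<open>2p + d = 2k + 1\<close>, with \<open>d\<close> now read as a degree
  in the contracted tree. It yields odd degrees, equality in condition (b), and that no pendant edge
  is missing.\<close>

lemma center_count:
  assumes x: "x \<in> centers"
  shows "card {y. (x, y) \<in> hub_link} + 2 * card {v. f v x = 2} = 2 * k + 1"
proof -
  have "load f x = 2 * k + 1"
    using tree_component_saturated[OF f_minimal X_component X_double] x by (simp add: centers_def)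
  then show ?thesis using load_eq[OF f_complete, of x] card_hub_link[OF x] by simp
qed

lemma finite_centers_pendants: "finite (centers \<union> pendants)"
  using X_sub finite_V finite_subset by (metis X_minus_doubles finite_Diff)

lemma pendants_at: "x \<in> centers \<Longrightarrow> {v. f v x = 2} = {v. (v, x) \<in> pendant_link}"
  using closed'[of x] by (auto simp: pendant_link_def centers_def)

text \<open>Ensures that no center becomes a leaf of the skeleton: a single link would account for
  at most two units, but a center holds at least five.\<close>

lemma card_links_center:
  assumes x: "x \<in> centers"
  shows "card {y. (x, y) \<in> links} \<noteq> 1"
proof -
  have eq: "{y. (x, y) \<in> links} = {y. (x, y) \<in> hub_link} \<union> {v. f v x = 2}"
    unfolding pendants_at[OF x] links_def using x centers_pendants by (auto dest: pendant_link_D)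
  have fin: "finite {y. (x, y) \<in> hub_link}" "finite {v. (v, x) \<in> pendant_link}"
    by (rule finite_subset[OF _ finite_centers_pendants]; auto dest: hub_link_centers pendant_link_D)+
  have "{y. (x, y) \<in> hub_link} \<inter> {v. f v x = 2} = {}"
    unfolding pendants_at[OF x] using centers_pendants by (auto dest!: hub_link_centers pendant_link_D)
  then have "card {y. (x, y) \<in> links} = card {y. (x, y) \<in> hub_link} + card {v. f v x = 2}"
    unfolding eq using fin by (intro card_Un_disjoint) (simp_all add: pendants_at[OF x])
  then show ?thesis using center_count[OF x] k_ge_2 by linarith
qed

section \<open>The contracted tree\<close>

text \<open>
  The tree \<open>R\<close> of the family. It already contains all pendant vertices, so that \<open>expand_tree\<close> adds
  no new pendant edges.
\<close>

definition skeleton :: "'b pair_pre_digraph" where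
  "skeleton = image_graph h (centers \<union> pendants) links"

lemma h_inj': "inj_on h (centers \<union> pendants)"
  using h_inj X_sub by (auto simp: centers_def pendants_def intro: inj_on_subset)

lemma h_eq: "a \<in> centers \<union> pendants \<Longrightarrow> b \<in> centers \<union> pendants \<Longrightarrow> h a = h b \<longleftrightarrow> a = b"
  using h_inj' by (auto dest: inj_onD)

lemma skeleton_link:
  assumes "a \<in> centers \<union> pendants" "b \<in> centers \<union> pendants"
  shows "(h a, h b) \<in> parcs skeleton \<longleftrightarrow> (a, b) \<in> links"
proof
  assume "(h a, h b) \<in> parcs skeleton"
  then obtain a' b' where l: "(a', b') \<in> links" "h a' = h a" "h b' = h b" by (auto simp: skeleton_def)
  then have "a' = a" "b' = b" using h_eq assms links_sub by blast+
  with l show "(a, b) \<in> links" by simp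
qed (auto simp: skeleton_def)

lemma skeleton_verts: "pverts skeleton = h ` (centers \<union> pendants)"
  by (simp add: skeleton_def)

lemma pair_graph_skeleton: "pair_graph skeleton"
proof (rule pair_graphI)
  show "finite (pverts skeleton)" using finite_centers_pendants by (simp add: skeleton_verts)
  show "parcs skeleton \<subseteq> pverts skeleton \<times> pverts skeleton"
    using links_sub by (auto simp: skeleton_def)
  show "sym (parcs skeleton)" by (auto simp: skeleton_def sym_def dest: sym_links)
  show "(x, x) \<notin> parcs skeleton" for x
  proof
    assume "(x, x) \<in> parcs skeleton"
    then obtain a b where l: "(a, b) \<in> links" "x = h a" "x = h b" by (auto simp: skeleton_def)
    then have "a = b" using h_eq links_sub by blast
    with l show False using links_irrefl by simp
  qed
qed

lemma skeleton_nbrs: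
  "a \<in> centers \<union> pendants \<Longrightarrow> {w. (h a, w) \<in> parcs skeleton} = h ` {b. (a, b) \<in> links}"
proof -
  assume a: "a \<in> centers \<union> pendants"
  show ?thesis
  proof (intro set_eqI iffI)
    fix w assume w: "w \<in> {w. (h a, w) \<in> parcs skeleton}"
    then obtain c b where cb: "(c, b) \<in> links" "h c = h a" "w = h b" by (auto simp: skeleton_def)
    then have "c = a" using h_eq a links_sub by blast
    with cb show "w \<in> h ` {b. (a, b) \<in> links}" by blast
  next
    fix w assume "w \<in> h ` {b. (a, b) \<in> links}"
    then show "w \<in> {w. (h a, w) \<in> parcs skeleton}" by (auto simp: skeleton_def)
  qed
qed

lemma card_h_image: "B \<subseteq> centers \<union> pendants \<Longrightarrow> card (h ` B) = card B"
  using h_inj' by (blast intro: card_image inj_on_subset)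

lemma skeleton_degree:
  assumes a: "a \<in> centers \<union> pendants"
  shows "out_degree (with_proj skeleton) (h a) = card {b. (a, b) \<in> links}"
proof -
  have "{b. (a, b) \<in> links} \<subseteq> centers \<union> pendants" using links_sub by blast
  then show ?thesis by (simp add: out_degree_eq_card skeleton_nbrs[OF a] card_h_image)
qed

lemma leaves_skeleton: "leaves skeleton = h ` pendants"
proof -
  have "card {b. (v, b) \<in> links} = 1" if v: "v \<in> pendants" for v
  proof -
    obtain x where "(v, x) \<in> pendant_link" using v by (auto simp: pendants_def pendant_link_def)
    then have "{b. (v, b) \<in> links} = {x}" using links_pendant(1) by blast
    then show ?thesis by simp
  qed
  then have "out_degree (with_proj skeleton) (h a) = 1 \<longleftrightarrow> a \<in> pendants" if "a \<in> centers \<union> pendants" for a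
    using that card_links_center[of a] by (auto simp: skeleton_degree)
  then show ?thesis unfolding leaves_def skeleton_verts by blast
qed

lemma nonleaves_skeleton: "pverts skeleton - leaves skeleton = h ` centers"
  unfolding leaves_skeleton skeleton_verts using h_eq centers_pendants by blast

lemma arcs_without_leaves: "arcs (without_leaves skeleton) = map_prod h h ` hub_link"
proof -
  have h_mem: "h a \<in> h ` centers \<longleftrightarrow> a \<in> centers" if "a \<in> centers \<union> pendants" for a
    using that h_eq by blast
  have "arcs (without_leaves skeleton) = {e \<in> map_prod h h ` links. fst e \<in> h ` centers \<and> snd e \<in> h ` centers}"
    unfolding without_leaves_def nonleaves_skeleton by (auto simp: skeleton_def)
  also have "\<dots> = map_prod h h ` {e \<in> links. fst e \<in> centers \<and> snd e \<in> centers}"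
  proof (intro set_eqI iffI)
    fix e assume "e \<in> {e \<in> map_prod h h ` links. fst e \<in> h ` centers \<and> snd e \<in> h ` centers}"
    then obtain a b where l: "(a, b) \<in> links" "e = (h a, h b)" "h a \<in> h ` centers" "h b \<in> h ` centers"
      by auto
    then have "a \<in> centers" "b \<in> centers" using links_sub h_mem by blast+
    with l show "e \<in> map_prod h h ` {e \<in> links. fst e \<in> centers \<and> snd e \<in> centers}" by force
  qed auto
  also have "{e \<in> links. fst e \<in> centers \<and> snd e \<in> centers} = hub_link"
    by (auto simp: links_centers[symmetric])
  finally show ?thesis .
qed

lemma inner_degree:
  assumes x: "x \<in> centers"
  shows "out_degree (without_leaves skeleton) (h x) = card {y. (x, y) \<in> hub_link}"
proof -
  have "tail (without_leaves skeleton) = fst" by (simp add: without_leaves_def)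
  moreover have "{w. (h x, w) \<in> map_prod h h ` hub_link} = h ` {y. (x, y) \<in> hub_link}"
  proof (intro set_eqI iffI)
    fix w assume "w \<in> {w. (h x, w) \<in> map_prod h h ` hub_link}"
    then obtain a b where l: "(a, b) \<in> hub_link" "h a = h x" "w = h b" by auto
    then have "a = x" using x h_eq hub_link_centers by blast
    with l show "w \<in> h ` {y. (x, y) \<in> hub_link}" by blast
  qed (auto intro: image_eqI[of _ _ "(x, _)"])
  moreover have "{y. (x, y) \<in> hub_link} \<subseteq> centers \<union> pendants" using hub_link_centers by blast
  ultimately show ?thesis by (simp add: out_degree_eq_card arcs_without_leaves card_h_image)
qed

lemma card_leaf_nbrs:
  assumes x: "x \<in> centers"
  shows "card (leaf_nbrs skeleton (h x)) = card {v. f v x = 2}"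
proof -
  have "leaf_nbrs skeleton (h x) = h ` {v \<in> pendants. (x, v) \<in> links}"
    unfolding leaf_nbrs_def leaves_skeleton using x skeleton_link by blast
  also have "{v \<in> pendants. (x, v) \<in> links} = {v. f v x = 2}"
    unfolding pendants_at[OF x] using x pendant_link_D[of _ x] links_pendant(2)
    by (auto simp: pendants_def pendant_link_def)
  finally show ?thesis using pendant_link_D by (subst card_h_image[symmetric]) (auto simp: pendants_at[OF x])
qed

text \<open>A long cycle pulls back along \<open>h\<close> to a cyclic set \<open>S\<close> of
  links. It avoids pendant vertices, so it runs through doubles only, and rotating these contradicts
  minimality.\<close>

lemma skeleton_no_cycle: "\<not> (\<exists>p. pre_digraph.cycle (with_proj skeleton) p \<and> 3 \<le> length p)"
proof
  assume "\<exists>p. pre_digraph.cycle (with_proj skeleton) p \<and> 3 \<le> length p"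
  then obtain p where p: "pre_digraph.cycle (with_proj skeleton) p" "3 \<le> length p" by blast
  interpret R: pair_graph skeleton by (rule pair_graph_skeleton)
  obtain S' where S': "S' \<subseteq> parcs skeleton" "finite S'" "S' \<noteq> {}" "inj_on fst S'" "inj_on snd S'"
    "fst ` S' = snd ` S'" "\<And>x y. (x, y) \<in> S' \<Longrightarrow> (y, x) \<notin> S'"
    using long_cycle_arcs[OF R.pair_wf_digraph p] by metis
  define S where "S = {e \<in> links. map_prod h h e \<in> S'}"
  have links_V: "a \<in> centers \<union> pendants" "b \<in> centers \<union> pendants" if "(a, b) \<in> links" for a b
    using that links_sub by blast+
  have S'_eq: "S' = map_prod h h ` S"
  proof (intro equalityI subsetI)
    fix e assume e: "e \<in> S'"
    with S'(1) have "e \<in> map_prod h h ` links" unfolding skeleton_def image_graph_simps by (rule subsetD)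
    then obtain d where "d \<in> links" "e = map_prod h h d" by (rule imageE)
    with e show "e \<in> map_prod h h ` S" unfolding S_def by (intro image_eqI[of _ _ d]) simp_all
  next
    fix e assume "e \<in> map_prod h h ` S" then show "e \<in> S'" unfolding S_def by (elim imageE) simp
  qed
  have finS: "finite S"
    using finite_subset[of S "(centers \<union> pendants) \<times> (centers \<union> pendants)"] links_sub finite_centers_pendants
    by (auto simp: S_def)
  have asym: "(b, a) \<notin> S" if "(a, b) \<in> S" for a b using that S'(7)[of "h a" "h b"] by (auto simp: S_def)
  have fstS: "h ` fst ` S = fst ` S'" "h ` snd ` S = snd ` S'" unfolding S'_eq by force+
  have subV: "fst ` S \<subseteq> centers \<union> pendants" "snd ` S \<subseteq> centers \<union> pendants"
    by (auto simp: S_def dest: links_V)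
  have cyc: "fst ` S = snd ` S"
    using inj_on_image_eq_iff[OF h_inj' subV] fstS S'(6) by simp
  have injf: "inj_on fst S"
  proof (rule inj_onI)
    fix e e' assume e: "e \<in> S" "e' \<in> S" "fst e = fst e'"
    then have "map_prod h h e = map_prod h h e'"
      using inj_onD[OF S'(4), of "map_prod h h e" "map_prod h h e'"] by (simp add: S_def)
    moreover have "e \<in> (centers \<union> pendants) \<times> (centers \<union> pendants)" "e' \<in> (centers \<union> pendants) \<times> (centers \<union> pendants)"
      using e(1,2) links_sub unfolding S_def by blast+
    ultimately show "e = e'" by (rule inj_onD[OF map_prod_inj_on[OF h_inj' h_inj']])
  qed
  have injs: "inj_on snd S"
  proof (rule inj_onI)
    fix e e' assume e: "e \<in> S" "e' \<in> S" "snd e = snd e'"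
    then have "map_prod h h e = map_prod h h e'"
      using inj_onD[OF S'(5), of "map_prod h h e" "map_prod h h e'"] by (simp add: S_def)
    moreover have "e \<in> (centers \<union> pendants) \<times> (centers \<union> pendants)" "e' \<in> (centers \<union> pendants) \<times> (centers \<union> pendants)"
      using e(1,2) links_sub unfolding S_def by blast+
    ultimately show "e = e'" by (rule inj_onD[OF map_prod_inj_on[OF h_inj' h_inj']])
  qed
  \<comment> \<open>A pendant vertex has one link, so a cycle through it would have to use that link
    in both directions.\<close>
  have hub: "e \<in> hub_link" if "e \<in> S" for e
  proof (rule ccontr)
    assume n: "e \<notin> hub_link"
    obtain a b where ab: "e = (a, b)" by force
    have mem: "a \<in> snd ` S" "b \<in> fst ` S" using that ab cyc by force+
    from n that ab consider "(a, b) \<in> pendant_link" | "(b, a) \<in> pendant_link"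
      by (auto simp: S_def links_def)
    then show False
    proof cases
      case 1
      obtain c where c: "(c, a) \<in> S" using mem by auto
      then have "c = b" using links_pendant(2)[OF 1] by (auto simp: S_def)
      then show False using asym c that ab by blast
    next
      case 2
      obtain c where c: "(b, c) \<in> S" using mem by auto
      then have "c = a" using links_pendant(1)[OF 2] by (auto simp: S_def)
      then show False using asym c that ab by blast
    qed
  qed
  \<comment> \<open>A double determines its unordered pair of hubs, and \<open>asym\<close> excludes
    the reversed pair.\<close>
  have inj_mid: "inj_on mid S"
  proof (rule inj_onI)
    fix e e' assume e: "e \<in> S" "e' \<in> S" "mid e = mid e'"
    obtain a b c d where abcd: "e = (a, b)" "e' = (c, d)" by force
    have "{a, b} = {c, d}" using mid(3)[of a b] mid(3)[of c d] hub e abcd by metis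
    then show "e = e'" using asym[of a b] e abcd by (auto simp: doubleton_eq_iff)
  qed
  have "S \<noteq> {}" using S'(3) S'_eq by blast
  then show False
    using minimal_no_rotation[OF f_minimal finS _ inj_mid _ injf injs cyc] mid(1,2) hub hub_link_centers by blast
qed

text \<open>A path in the factor may pass through doubles, which are not vertices of the skeleton.
  The induction therefore claims that the current vertex is reachable if it is no double, and that
  all its hubs are reachable if it is one.\<close>

lemma skeleton_reachable:
  assumes a: "a \<in> centers \<union> pendants" and b: "b \<in> centers \<union> pendants"
  shows "(h a, h b) \<in> (parcs skeleton)\<^sup>*"
proof -
  let ?R = "(parcs skeleton)\<^sup>*"
  have arc: "(h x, h y) \<in> parcs skeleton" if "(x, y) \<in> links" for x y
    using that skeleton_link[of x y] links_sub by blast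
  have aX: "a \<in> X" "a \<notin> doubles f" and bX: "b \<in> X" "b \<notin> doubles f" using a b X_minus_doubles by auto
  have "(a, b) \<in> (parcs (factor f))\<^sup>*" using X_component aX bX unfolding component_def by blast
  then have "b \<in> X \<and> (b \<notin> doubles f \<longrightarrow> (h a, h b) \<in> ?R) \<and> (\<forall>c. f b c = 1 \<longrightarrow> (h a, h c) \<in> ?R)"
  proof (induction rule: rtrancl_induct)
    case base
    then show ?case using aX by (auto simp: doubles_def hubs_def)
  next
    case (step y z)
    have yX: "y \<in> X" and IH1: "y \<notin> doubles f \<Longrightarrow> (h a, h y) \<in> ?R" and IH2: "\<And>c. f y c = 1 \<Longrightarrow> (h a, h c) \<in> ?R"
      using step.IH by auto
    have yz: "0 < f y z \<or> 0 < f z y" using step.hyps by simp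
    have zX: "z \<in> X" using component_closed[OF X_component yX yz] .
    have zy: "z \<notin> doubles f" if "0 < f y z" using centers_I[OF zX that] X_minus_doubles by blast
    have yc: "y \<in> centers" if "0 < f z y" using centers_I yX that by blast
    have z1: "(h a, h z) \<in> ?R" if nd: "z \<notin> doubles f"
    proof -
      consider "f y z = 1" | "f y z = 2" | "f z y = 2" | "f z y = 1"
        using yz satellite_values[OF f_complete] by blast
      then show ?thesis
      proof cases
        case 1 then show ?thesis by (rule IH2)
      next
        case 2
        then have l: "(y, z) \<in> pendant_link" using yX by (simp add: pendant_link_def)
        then have "y \<notin> doubles f" using pendant_link_D X_minus_doubles by blast
        then show ?thesis using IH1 arc[of y z] l
          by (auto simp: links_def intro: rtrancl_into_rtrancl)
      next
        case 3
        then have l: "(z, y) \<in> pendant_link" using zX by (simp add: pendant_link_def)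
        then have "y \<notin> doubles f" using pendant_link_D X_minus_doubles by blast
        then show ?thesis using IH1 arc[of y z] l
          by (auto simp: links_def intro: rtrancl_into_rtrancl)
      next
        case 4 then show ?thesis using nd by (auto simp: doubles_def hubs_def)
      qed
    qed
    \<comment> \<open>The path enters the double \<open>z\<close> from one of its hubs
      \<open>y\<close>, and the other hub is linked to \<open>y\<close>.\<close>
    have z2: "(h a, h c) \<in> ?R" if c: "f z c = 1" for c
    proof -
      have zd: "z \<in> doubles f" using c by (auto simp: doubles_def hubs_def)
      then have zy0: "0 < f z y" using zy yz by auto
      have fzy: "f z y = 1"
        using satellite_values[OF f_complete zy0] single_row[OF f_complete, of z y c] c by (auto split: if_splits)
      have "y \<notin> doubles f" using yc[OF zy0] X_minus_doubles by blast
      then have ay: "(h a, h y) \<in> ?R" by (rule IH1)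
      show ?thesis
      proof (cases "c = y")
        case False
        then have "(y, c) \<in> links" using hub_link_I[OF yX fzy c] by (simp add: links_def)
        then show ?thesis using ay arc[of y c]
          by (auto intro: rtrancl_into_rtrancl)
      qed (use ay in simp)
    qed
    show ?case using zX z1 z2 by blast
  qed
  then show ?thesis using bX by blast
qed

text \<open>Connectedness refers to the symmetric closure, which does not change reachability here
  because the skeleton is symmetric.\<close>

lemma skeleton_connected: "Digraph_Component.connected (with_proj skeleton)"
proof -
  interpret R: pair_graph skeleton by (rule pair_graph_skeleton)
  have "reachable (with_proj (mk_symmetric (with_proj skeleton))) u v"
    if "u \<in> pverts skeleton" "v \<in> pverts skeleton" for u v
    using that skeleton_reachable
    by (auto simp: R.reachable_mk_symmetric_eq[OF R.sym_arcs] R.reachable_conv' skeleton_verts)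
  moreover have "pverts skeleton \<noteq> {}"
    using component_center[OF f_complete X_component] by (force simp: skeleton_verts centers_def)
  ultimately show ?thesis
    unfolding Digraph_Component.connected_def by (intro strongly_connectedI) auto
qed

lemma admissible_skeleton: "admissible_tree k skeleton"
  unfolding admissible_tree_def
proof (intro conjI ballI)
  show "undirected_tree skeleton"
    unfolding undirected_tree_def using pair_graph_skeleton skeleton_connected skeleton_no_cycle by blast
  fix w assume "w \<in> pverts skeleton - leaves skeleton"
  then obtain x where x: "x \<in> centers" "w = h x" unfolding nonleaves_skeleton by blast
  note count = center_count[OF x(1)]
  show "2 * card (leaf_nbrs skeleton w) + out_degree (without_leaves skeleton) w \<le> 2 * k + 1"
    using count x by (simp add: inner_degree card_leaf_nbrs)
  \<comment> \<open>With \<open>p\<close> pendant vertices at \<open>x\<close>, the witness for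
    \<open>r\<close> is \<open>k - p\<close>; it does not truncate, since \<open>2p\<close> is at
    most \<open>2k + 1\<close>.\<close>
  have "card {y. (x, y) \<in> hub_link} = 2 * (k - card {v. f v x = 2}) + 1" using count by linarith
  then show "out_degree (without_leaves skeleton) w \<in> {2 * r + 1 | r. r \<le> k}"
    unfolding x(2) inner_degree[OF x(1)] by (intro CollectI exI[of _ "k - card {v. f v x = 2}"]) simp
qed

text \<open>If the inner degree is \<open>2r + 1\<close>, then \<open>center_count\<close> makes the
  number of adjacent leaves exactly \<open>k - r\<close>, so nothing remains to be attached.\<close>

lemma new_pendants_skeleton: "new_pendants k skeleton = {}"
proof -
  have False if "(w, i) \<in> new_pendants k skeleton" for w i
  proof -
    from that obtain r where w: "w \<in> pverts skeleton - leaves skeleton"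
      and r: "out_degree (without_leaves skeleton) w = 2 * r + 1"
        "i < k - r - card (leaf_nbrs skeleton w)"
      by (auto simp: new_pendants_def)
    from w obtain x where x: "x \<in> centers" "w = h x" unfolding nonleaves_skeleton by blast
    show False
      using r center_count[OF x(1)] unfolding x(2) inner_degree[OF x(1)] card_leaf_nbrs[OF x(1)] by linarith
  qed
  then show ?thesis by auto
qed

section \<open>Identifying the component with the expanded skeleton\<close>

definition to_expanded :: "'a \<Rightarrow> 'b expanded_vertex" where
  "to_expanded v = (if v \<in> doubles f then Mid (h ` hubs f v) else Orig (h v))"

lemma double_hubs:
  assumes "m \<in> X \<inter> doubles f"
  obtains x y where "(x, y) \<in> hub_link" "hubs f m = {x, y}" "f m x = 1" "f m y = 1"
proof -
  obtain x where x: "f m x = 1" using assms by (auto simp: doubles_def hubs_def)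
  obtain y where "y \<noteq> x" "f m = (\<lambda>c. if c = x \<or> c = y then 1 else 0)"
    using double_row[OF f_complete x] .
  then have y: "f m y = 1" "x \<noteq> y" by auto
  have "x \<in> X" using closed[of m x] assms x by simp
  then show thesis using that[of x y] hub_link_I[of x m y] hubs_eq(1)[OF f_complete x y] x y by blast
qed

lemma mid_X: "(x, y) \<in> hub_link \<Longrightarrow> mid (x, y) \<in> X \<inter> doubles f"
  using mid[of x y] closed'[of x "mid (x, y)"] by (auto simp: hub_link_def doubles_def)

text \<open>A double is named after its hubs only, which is faithful by
  \<open>double_unique\<close>.\<close>

lemma to_expanded_inj: "inj_on to_expanded X"
proof (rule inj_onI)
  fix u v assume uv: "u \<in> X" "v \<in> X" and eq: "to_expanded u = to_expanded v"
  show "u = v"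
  proof (cases "u \<in> doubles f")
    case True
    then have vd: "v \<in> doubles f" and img: "h ` hubs f u = h ` hubs f v"
      using eq by (auto simp: to_expanded_def split: if_splits)
    obtain x y where xy: "(x, y) \<in> hub_link" "hubs f u = {x, y}" "f u x = 1" "f u y = 1"
      using double_hubs[of u] uv True by blast
    obtain x' y' where xy': "(x', y') \<in> hub_link" "hubs f v = {x', y'}" "f v x' = 1" "f v y' = 1"
      using double_hubs[of v] uv vd by blast
    have "hubs f u = hubs f v"
      using inj_on_image_eq_iff[OF h_inj', of "hubs f u" "hubs f v"] img
        hub_link_centers[OF xy(1)] hub_link_centers[OF xy'(1)] unfolding xy(2) xy'(2) by blast
    then have "f v x = 1" "f v y = 1" using xy(3,4) by (auto simp: hubs_def)
    then show ?thesis using double_unique[OF f_minimal xy(3,4)] hub_link_centers[OF xy(1)] by blast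
  next
    case False
    then have "v \<notin> doubles f" "h u = h v" using eq by (auto simp: to_expanded_def split: if_splits)
    then show ?thesis using False uv h_eq[of u v] X_minus_doubles by blast
  qed
qed

text \<open>Oriented from the center to the double, as in the arcs
  \<open>(Orig x, Mid {x, y})\<close> of \<open>expand_tree\<close>; the converse is added
  afterwards.\<close>

definition hub_arcs :: "('a \<times> 'a) set" where
  "hub_arcs = {(x, m). x \<in> X \<and> f m x = 1}"

lemma factor_arcs:
  "parcs (factor f) \<inter> X \<times> X = (pendant_link \<union> pendant_link\<inverse>) \<union> (hub_arcs \<union> hub_arcs\<inverse>)"
proof (intro set_eqI iffI)
  fix e assume "e \<in> parcs (factor f) \<inter> X \<times> X"
  then obtain a b where e: "e = (a, b)" "a \<in> X" "b \<in> X" "0 < f a b \<or> 0 < f b a" by (cases e) auto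
  then have "f a b = 1 \<or> f a b = 2 \<or> f b a = 1 \<or> f b a = 2" using satellite_values[OF f_complete] by blast
  then show "e \<in> (pendant_link \<union> pendant_link\<inverse>) \<union> (hub_arcs \<union> hub_arcs\<inverse>)"
    using e by (auto simp: pendant_link_def hub_arcs_def)
next
  fix e assume "e \<in> (pendant_link \<union> pendant_link\<inverse>) \<union> (hub_arcs \<union> hub_arcs\<inverse>)"
  then consider (pendant) a b where "f a b = 2" "a \<in> X" "e = (a, b) \<or> e = (b, a)"
    | (hub) a b where "f a b = 1" "b \<in> X" "e = (a, b) \<or> e = (b, a)"
    by (auto simp: pendant_link_def hub_arcs_def)
  then have "\<exists>a b. 0 < f a b \<and> (a \<in> X \<or> b \<in> X) \<and> (e = (a, b) \<or> e = (b, a))"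
    by cases (metis zero_less_numeral, metis zero_less_one)
  then obtain a b where "0 < f a b" "a \<in> X \<or> b \<in> X" "e = (a, b) \<or> e = (b, a)" by blast
  then show "e \<in> parcs (factor f) \<inter> X \<times> X" using closed[of a b] closed'[of b a] by auto
qed

lemma to_expanded_center: "x \<in> centers \<union> pendants \<Longrightarrow> to_expanded x = Orig (h x)"
  using X_minus_doubles by (auto simp: to_expanded_def)

lemma pendant_arcs_expanded:
  "{(Orig x, Orig y) | x y. (x, y) \<in> parcs skeleton - arcs (without_leaves skeleton)} =
     map_prod to_expanded to_expanded ` (pendant_link \<union> pendant_link\<inverse>)"
proof -
  have sub: "hub_link \<subseteq> links" by (auto simp: links_def)
  have inj: "inj_on (map_prod h h) links"
    by (rule inj_on_subset[OF map_prod_inj_on[OF h_inj' h_inj'] links_sub])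
  have "parcs skeleton - arcs (without_leaves skeleton) = map_prod h h ` (links - hub_link)"
    using inj_on_image_set_diff[OF inj _ sub, of links] by (simp add: arcs_without_leaves) (simp add: skeleton_def)
  also have "links - hub_link = pendant_link \<union> pendant_link\<inverse>"
    unfolding links_def using centers_pendants by (auto dest!: pendant_link_D hub_link_centers)
  finally have diff: "parcs skeleton - arcs (without_leaves skeleton) = map_prod h h ` (pendant_link \<union> pendant_link\<inverse>)" .
  have "{(Orig x, Orig y) | x y. (x, y) \<in> map_prod h h ` B} = map_prod (\<lambda>v. Orig (h v)) (\<lambda>v. Orig (h v)) ` B" for B
    by force
  then have "{(Orig x, Orig y) | x y. (x, y) \<in> parcs skeleton - arcs (without_leaves skeleton)} =
      map_prod (\<lambda>v. Orig (h v)) (\<lambda>v. Orig (h v)) ` (pendant_link \<union> pendant_link\<inverse>)"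
    unfolding diff .
  also have "\<dots> = map_prod to_expanded to_expanded ` (pendant_link \<union> pendant_link\<inverse>)"
    by (intro image_cong refl) (auto dest!: pendant_link_D simp: to_expanded_center)
  finally show ?thesis .
qed

lemma hub_arcs_expanded:
  "{(Orig x, Mid {x, y}) | x y. (x, y) \<in> arcs (without_leaves skeleton)} =
     map_prod to_expanded to_expanded ` hub_arcs"
proof (intro set_eqI iffI)
  fix e assume "e \<in> {(Orig x, Mid {x, y}) | x y. (x, y) \<in> arcs (without_leaves skeleton)}"
  then obtain x y where xy: "(x, y) \<in> hub_link" "e = (Orig (h x), Mid {h x, h y})"
    by (auto simp: arcs_without_leaves)
  have "to_expanded (mid (x, y)) = Mid {h x, h y}"
    using mid_X[OF xy(1)] mid(3)[OF xy(1)] by (simp add: to_expanded_def)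
  moreover have "to_expanded x = Orig (h x)" using hub_link_centers[OF xy(1)] by (simp add: to_expanded_center)
  moreover have "(x, mid (x, y)) \<in> hub_arcs" using mid(1)[OF xy(1)] xy(1) by (simp add: hub_arcs_def hub_link_def)
  ultimately show "e \<in> map_prod to_expanded to_expanded ` hub_arcs"
    using xy(2) by (intro image_eqI[of _ _ "(x, mid (x, y))"]) simp_all
next
  fix e assume "e \<in> map_prod to_expanded to_expanded ` hub_arcs"
  then obtain x m where xm: "x \<in> X" "f m x = 1" "e = (to_expanded x, to_expanded m)" by (auto simp: hub_arcs_def)
  have m: "m \<in> X \<inter> doubles f" using closed'[of x m] xm by (auto simp: doubles_def hubs_def)
  obtain y where "y \<noteq> x" "f m = (\<lambda>c. if c = x \<or> c = y then 1 else 0)"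
    using double_row[OF f_complete xm(2)] .
  then have y: "f m y = 1" "x \<noteq> y" by auto
  have l: "(x, y) \<in> hub_link" using hub_link_I[OF xm(1,2) y] .
  have "to_expanded m = Mid {h x, h y}"
    using m hubs_eq(1)[OF f_complete xm(2) y] by (simp add: to_expanded_def)
  moreover have "to_expanded x = Orig (h x)" using hub_link_centers[OF l] by (simp add: to_expanded_center)
  moreover have "(h x, h y) \<in> arcs (without_leaves skeleton)" unfolding arcs_without_leaves using l by force
  ultimately show "e \<in> {(Orig x, Mid {x, y}) | x y. (x, y) \<in> arcs (without_leaves skeleton)}"
    using xm(3) by blast
qed

lemma verts_expanded:
  "Orig ` pverts skeleton \<union> {Mid {x, y} | x y. (x, y) \<in> arcs (without_leaves skeleton)} = to_expanded ` X"
proof -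
  have "to_expanded ` X = to_expanded ` (centers \<union> pendants) \<union> to_expanded ` (X \<inter> doubles f)"
    by (metis Un_Diff_Int X_minus_doubles image_Un)
  also have "to_expanded ` (centers \<union> pendants) = Orig ` pverts skeleton"
    unfolding skeleton_verts image_image by (intro image_cong refl) (simp add: to_expanded_center)
  also have "to_expanded ` (X \<inter> doubles f) = {Mid {x, y} | x y. (x, y) \<in> arcs (without_leaves skeleton)}"
  proof (intro set_eqI iffI)
    fix w assume "w \<in> to_expanded ` (X \<inter> doubles f)"
    then obtain m where m: "m \<in> X \<inter> doubles f" "w = to_expanded m" by blast
    obtain x y where "(x, y) \<in> hub_link" "hubs f m = {x, y}" using double_hubs[OF m(1)] .
    then show "w \<in> {Mid {x, y} | x y. (x, y) \<in> arcs (without_leaves skeleton)}"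
      using m by (auto simp: to_expanded_def arcs_without_leaves)
  next
    fix w assume "w \<in> {Mid {x, y} | x y. (x, y) \<in> arcs (without_leaves skeleton)}"
    then obtain x y where xy: "(x, y) \<in> hub_link" "w = Mid {h x, h y}" by (auto simp: arcs_without_leaves)
    then have "w = to_expanded (mid (x, y))"
      using mid_X[OF xy(1)] mid(3)[OF xy(1)] by (simp add: to_expanded_def)
    then show "w \<in> to_expanded ` (X \<inter> doubles f)" using mid_X[OF xy(1)] by blast
  qed
  finally show ?thesis by simp
qed

text \<open>An equality and not only an isomorphism, because \<open>to_expanded\<close> uses the
  vertex names of \<open>expand_tree\<close> itself.\<close>

lemma expand_skeleton:
  "expand_tree k skeleton = image_graph to_expanded X (parcs (factor f) \<inter> X \<times> X)"
proof -
  have conv: "(map_prod to_expanded to_expanded ` B)\<inverse> = map_prod to_expanded to_expanded ` (B\<inverse>)" for B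
    by (auto simp: image_iff)
  show ?thesis
    unfolding expand_tree_def Let_def new_pendants_skeleton pendant_arcs_expanded hub_arcs_expanded
      image_graph_def factor_arcs
    by (simp add: verts_expanded converse_Un conv image_Un Un_ac)
qed

end

section \<open>Assembling the factor\<close>

context finite_graph
begin

lemma component_in_family:
  assumes f: "minimal f" and X: "component f X"
  shows "\<exists>H\<in>stars_upto k \<union> tree_family k. digraph_iso (with_proj (factor f) \<restriction> X) (with_proj H)"
proof -
  obtain h :: "'a \<Rightarrow> nat" where h: "inj_on h V" using finite_imp_inj_to_nat_seg[OF finite_V] by blast
  have XV: "X \<subseteq> V" using X unfolding component_def by blast
  show ?thesis
  proof (cases "X \<inter> doubles f = {}")
    case True
    \<comment> \<open>The constructor \<open>Orig\<close> only moves the star into the vertex type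
      of the tree family.\<close>
    have "inj_on (\<lambda>v. Orig (h v)) X" using h XV by (auto simp: inj_on_def)
    from star_component[OF _ X True this] image_graph_iso[OF this, of "factor f"] show ?thesis
      using f unfolding minimal_def by blast
  next
    case False
    interpret tree_component V E k f X h
      using f X False h by unfold_locales
    have "expand_tree k skeleton \<in> tree_family k" using admissible_skeleton by (auto simp: tree_family_def)
    then show ?thesis using image_graph_iso[OF to_expanded_inj, of "factor f"] unfolding expand_skeleton by blast
  qed
qed

end

theorem theorem1p5:
  fixes G :: "'a pair_pre_digraph" and k :: nat
  assumes "k \<ge> 2"
    and "pair_graph G"
    and "real (min_degree G) \<ge> 2 * real (independence_number G) / (2 * real k + 1)"
  shows "has_factor (stars_upto k \<union> tree_family k) G"
proof -
  interpret G: pair_graph G by fact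
  interpret finite_graph "pverts G" "parcs G" k
    using assms(1) G.pair_finite_verts
    by unfold_locales (auto intro: G.arcs_symmetric dest: G.in_arcsD1 G.in_arcsD2 G.no_loops')
  \<comment> \<open>For independent \<open>I\<close> this is the chain \<open>2|I| \<le> 2 \<alpha>
    \<le> (2k + 1) \<delta> \<le> (2k + 1)|N(I)|\<close>, the last step because \<open>N(I)\<close>
    contains the neighbours of any single \<open>v\<close> in \<open>I\<close>.\<close>
  have hall: "2 * card I \<le> (2 * k + 1) * card (parcs G `` I)"
    if I: "I \<subseteq> pverts G" "I \<noteq> {}" "\<And>u v. u \<in> I \<Longrightarrow> v \<in> I \<Longrightarrow> (u, v) \<notin> parcs G" for I
  proof -
    \<comment> \<open>As \<open>I\<close> has an element, the graph is not null and its minimum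
      degree is a genuine minimum.\<close>
    obtain v where v: "v \<in> I" using I by blast
    have "finite {S. independent_set G S}"
      by (rule finite_subset[of _ "Pow (pverts G)"]) (auto simp: independent_set_def G.pair_finite_verts)
    moreover have "independent_set G I" using I by (simp add: independent_set_def)
    ultimately have "card I \<le> independence_number G"
      unfolding independence_number_def by (intro Max_ge) simp_all
    moreover have "2 * independence_number G \<le> (2 * k + 1) * min_degree G"
    proof -
      have "2 * real (independence_number G) \<le> real (min_degree G) * (2 * real k + 1)"
        using assms(3) by (simp add: divide_le_eq)
      also have "\<dots> = real ((2 * k + 1) * min_degree G)" by (simp add: algebra_simps)
      finally show ?thesis by (metis of_nat_le_iff of_nat_mult of_nat_numeral)
    qed
    moreover have "min_degree G \<le> out_degree (with_proj G) v"
      unfolding min_degree_def using v I G.pair_finite_verts by (intro Min_le) auto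
    moreover have "out_degree (with_proj G) v \<le> card (parcs G `` I)"
    proof -
      have "finite (parcs G `` I)" using G.pair_finite_arcs by (rule finite_Image)
      then show ?thesis using v by (auto simp: out_degree_eq_card intro!: card_mono)
    qed
    ultimately show ?thesis by (meson le_trans mult_le_mono2)
  qed
  then obtain f where f: "minimal f" using ex_complete ex_minimal by metis
  then have vf: "valid f" by (simp add: minimal_def complete_def)
  interpret F: pair_graph "factor f" using pair_graph_factor[OF vf] .
  have "spanning (with_proj (factor f)) (with_proj G)"
    unfolding spanning_def subgraph_def using factor_subset[OF vf]
    by (simp add: G.wf_digraph F.wf_digraph compatibleI_with_proj)
  moreover have "\<exists>H\<in>stars_upto k \<union> tree_family k. digraph_iso C (with_proj H)"
    if "C \<in> pre_digraph.sccs (with_proj (factor f))" for C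
    using pair_graph_scc[OF F.pair_graph that] component_in_family[OF f] unfolding component_def
    by (metis factor_simps(1))
  ultimately show ?thesis
    unfolding has_factor_def using F.pair_graph by blast
qed

end
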